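(* Let $X_1,X_2,\dots$ be i.i.d. real random variables with mean $u$ and variance $\sigma^2\in(0,\infty)$. Let $\varphi:\mathbb{R}\to\mathbb{R}$ be continuous and non-decreasing with $$-\log(1-x+x^2/2)\le \varphi(x)\le \log(1+x+x^2/2)\qquad\text{for all }x\in\mathbb{R}.$$ Let $\alpha_n=a_n\sigma^{-1}$ with $a_n>0$, and suppose there is a constant $0\le C_0<\infty$ with $\limsup_{n\to\infty}\sqrt n\,a_n\le C_0$. Let $\hat\theta$ be a solution of $\sum_{i=1}^n\varphi[\alpha_n(X_i-\theta)]=0$ and let $u_n$ be any solution of $\mathbb{E}\{\varphi[\alpha_n(X_1-x)]\}=0$ in $x$. Then $$\sup_{z\in\mathbb{R}}\Big|\mathbb{P}\big(\sqrt n(\hat\theta-u_n)/\sigma\le z\big)-\Phi(z)\Big|\le C\beta_2+C\beta_3,$$ where $C$ is a positive constant depending on the distribution of $X_1$, and $$\beta_2=\frac1{\sigma^2}\mathbb{E}\big\{|X_1-u|^2\mathbf 1(|X_1-u|\ge\sqrt n\,\sigma)\big\},\qquad \beta_3=\frac1{\sqrt n\,\sigma^3}\mathbb{E}\big\{|X_1-u|^3\mathbf 1(|X_1-u|\le\sqrt n\,\sigma)\big\}.$$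
   Context: $\Phi$ denotes the standard normal distribution function. $\hat\theta=\hat\theta_n$ depends on $n$ and on $X_1,\dots,X_n$ (Catoni's estimator of the mean); $u_n$ is deterministic. The constant $C$ does not depend on $n$. *)

theory Defs
  imports "HOL-Probability.Probability"
begin

text \<open>The random variables are indexed from 1; \<open>X 0\<close> is unconstrained.\<close>

definition iid_sequence :: "'a measure \<Rightarrow> (nat \<Rightarrow> 'a \<Rightarrow> real) \<Rightarrow> real measure \<Rightarrow> bool" where
  "iid_sequence M X D \<longleftrightarrow>
     prob_space M \<and>
     prob_space.indep_vars M (\<lambda>_. borel) X {1..} \<and>
     (\<forall>i\<ge>1. distr M borel (X i) = D)"

definition catoni_influence :: "(real \<Rightarrow> real) \<Rightarrow> bool" where
  "catoni_influence \<phi> \<longleftrightarrow>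
     continuous_on UNIV \<phi> \<and> mono \<phi> \<and>
     (\<forall>x. - ln (1 - x + x\<^sup>2 / 2) \<le> \<phi> x \<and> \<phi> x \<le> ln (1 + x + x\<^sup>2 / 2))"

text \<open>The sigma-algebra generated by \<open>X\<^sub>1, \<dots>, X\<^sub>n\<close>. Measurability of the estimator with
  respect to it says that the estimator is a Borel function of the first \<open>n\<close> observations.\<close>

definition sample_algebra :: "'a measure \<Rightarrow> (nat \<Rightarrow> 'a \<Rightarrow> real) \<Rightarrow> nat \<Rightarrow> 'a measure" where
  "sample_algebra M X n =
     vimage_algebra (space M) (\<lambda>\<omega>. \<lambda>i\<in>{1..n}. X i \<omega>) (PiM {1..n} (\<lambda>_. borel))"

text \<open>The defining equation need not have a unique solution, so this is a predicate:
  \<open>\<theta>\<close> is some measurable choice of a solution.\<close>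

definition catoni_estimator ::
  "'a measure \<Rightarrow> (nat \<Rightarrow> 'a \<Rightarrow> real) \<Rightarrow> (real \<Rightarrow> real) \<Rightarrow> real \<Rightarrow> nat \<Rightarrow> ('a \<Rightarrow> real) \<Rightarrow> bool" where
  "catoni_estimator M X \<phi> \<alpha> n \<theta> \<longleftrightarrow>
     \<theta> \<in> borel_measurable (sample_algebra M X n) \<and>
     (\<forall>\<omega>\<in>space M. (\<Sum>i=1..n. \<phi> (\<alpha> * (X i \<omega> - \<theta> \<omega>))) = 0)"

text \<open>Below, expectations of functions of \<open>X\<^sub>1\<close> are integrals against its law \<open>D\<close>.
  If \<open>D\<close> has a finite second moment and \<open>\<phi>\<close> is a \<open>catoni_influence\<close>, then
  \<open>\<bar>\<phi> t\<bar> \<le> \<bar>t\<bar> + t\<^sup>2 / 2\<close>, so the integral in \<open>catoni_center\<close>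
  is a genuine one.\<close>

definition catoni_center :: "real measure \<Rightarrow> (real \<Rightarrow> real) \<Rightarrow> real \<Rightarrow> real \<Rightarrow> bool" where
  "catoni_center D \<phi> \<alpha> v \<longleftrightarrow> (\<integral>x. \<phi> (\<alpha> * (x - v)) \<partial>D) = 0"

definition beta2 :: "real measure \<Rightarrow> real \<Rightarrow> real \<Rightarrow> nat \<Rightarrow> real" where
  "beta2 D u \<sigma> n =
     1 / \<sigma>\<^sup>2 * (\<integral>x. \<bar>x - u\<bar> ^ 2 * indicator {x. \<bar>x - u\<bar> \<ge> sqrt (real n) * \<sigma>} x \<partial>D)"

definition beta3 :: "real measure \<Rightarrow> real \<Rightarrow> real \<Rightarrow> nat \<Rightarrow> real" where
  "beta3 D u \<sigma> n =
     1 / (sqrt (real n) * \<sigma> ^ 3) *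
       (\<integral>x. \<bar>x - u\<bar> ^ 3 * indicator {x. \<bar>x - u\<bar> \<le> sqrt (real n) * \<sigma>} x \<partial>D)"

end

theory Submission imports Defs
begin

text \<open>
  Standardise, so that the observations have mean 0 and variance 1, and put \<open>r = sqrt n\<close>,
  \<open>b = \<beta>\<^sub>2 + \<beta>\<^sub>3\<close>. Let \<open>A\<close> bound all the products \<open>sqrt n * a n\<close>.

  Since \<open>\<phi>\<close> is monotone, \<open>S(t) = \<Sum> \<phi>(a (X\<^sub>i - t))\<close> is non-increasing in \<open>t\<close>, and
  \<open>{S(t) < 0} \<subseteq> {\<theta> \<le> t} \<subseteq> {S(t) \<le> 0}\<close>. So the distribution function of the estimator at a fixed
  \<open>t\<close> is that of a sum of i.i.d. variables at 0, and the Berry-Esseen theorem can be applied for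
  each \<open>t\<close> separately, with a bound that is uniform in \<open>t\<close>. No expansion of the estimator itself
  is used.

  When \<open>a\<close> is much smaller than \<open>1 / r\<close>, the third moments of the summands are too large for
  this, so the summands are first set to 0 where \<open>\<bar>X\<^sub>i\<bar> > r\<close>. This changes the sum with
  probability at most \<open>n P(\<bar>X\<bar> > r) \<le> \<beta>\<^sub>2\<close>. The two logarithmic bounds on \<open>\<phi>\<close> agree with the
  identity up to second order, whence \<open>\<bar>\<phi> x - x\<bar> \<le> min (x\<^sup>2) \<bar>x\<bar>\<^sup>3\<close> (\<open>catoni_influence_bounds\<close>).
  The cubic bound is needed: with \<open>a \<le> A / r\<close> it shows for \<open>\<bar>t\<bar> \<le> 1\<close> that the rescaled truncated
  summand \<open>\<phi>(a (X - t)) / a\<close> has mean \<open>-t + O(b / r)\<close>, variance \<open>1 + O(b)\<close> and third absolute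
  moment \<open>O(r b)\<close> (\<open>mean_w\<close>, \<open>variance_w\<close>, \<open>third_central_moment_w\<close>). The quadratic bound alone
  would leave a mean error of order \<open>1 / r\<close> and hence an error of order 1 in the distribution
  function. It follows that \<open>P(\<theta> \<le> t) = \<Phi>(r t) + O(b)\<close> for \<open>\<bar>t\<bar> \<le> 1\<close> (\<open>cdf_estimator\<close>). For
  \<open>\<bar>t\<bar> > 1\<close> both sides are within \<open>O(b)\<close> of 0 or 1, by monotonicity and Chebyshev's inequality.

  The same estimate of the mean, applied to the equation \<open>E \<phi>(a (X - v)) = 0\<close>, gives
  \<open>r \<bar>v\<bar> = O(b)\<close> (\<open>scaled_center_le\<close>); as \<open>\<Phi>\<close> is Lipschitz, centring at \<open>v\<close> or at the mean makes
  no difference of larger order.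

  All of this tolerates errors of order \<open>1 / r\<close>, and this is where the constant depends on the
  law: \<open>b \<ge> c / r\<close> with \<open>c = E min(X\<^sup>2, \<bar>X\<bar>\<^sup>3) > 0\<close> (\<open>truncated_moment_le\<close>). Likewise \<open>b\<close> may be
  assumed small, because otherwise a multiple of \<open>b\<close> exceeds 1 and the claim is trivial.

  The Berry-Esseen theorem for i.i.d. summands (\<open>berry_esseen_iid\<close>) is proved by Fourier
  analysis: the distribution function is smoothed by a rescaled Fejer kernel, whose
  characteristic function has compact support; the Levy inversion formula turns a bound on
  characteristic functions into one on the smoothed distribution functions; and the smoothing is
  undone at the cost of the kernel's width.
\<close>

section \<open>Elementary inequalities\<close>

text \<open>
  Factor out \<open>m\<close> to reduce to complex numbers in the unit disc. The remaining factor
  \<open>m ^ (n - 1)\<close> is what later provides Gaussian decay for the difference of two characteristic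
  functions.
\<close>

lemma norm_power_diff_scaled:
  fixes a b :: complex
  assumes "norm a \<le> m" "norm b \<le> m" "0 < m" "n \<ge> 1"
  shows "norm (a ^ n - b ^ n) \<le> real n * norm (a - b) * m ^ (n - 1)"
proof -
  have "norm ((a / m) ^ n - (b / m) ^ n) \<le> real n * norm (a / m - b / m)"
    using assms by (intro norm_power_diff) (auto simp: norm_divide)
  also have "(a / m) ^ n - (b / m) ^ n = (a ^ n - b ^ n) / of_real (m ^ n)"
    by (simp add: power_divide diff_divide_distrib)
  also have "a / m - b / m = (a - b) / of_real m"
    by (simp add: diff_divide_distrib)
  finally have "norm (a ^ n - b ^ n) / m ^ n \<le> real n * (norm (a - b) / m)"
    using assms by (simp add: norm_divide norm_power)
  moreover have "m ^ n = m * m ^ (n - 1)" using assms by (cases n) auto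
  ultimately show ?thesis
    using assms by (simp add: field_simps)
qed

lemma exp_minus_le_quadratic:
  fixes y :: real assumes "0 \<le> y" shows "exp (- y) \<le> 1 - y + y\<^sup>2 / 2"
proof -
  let ?f = "\<lambda>y::real. 1 - y + y\<^sup>2 / 2 - exp (- y)"
  have "?f 0 \<le> ?f y"
  proof (rule DERIV_nonneg_imp_nondecreasing[OF assms])
    fix z :: real
    have "DERIV ?f z :> - 1 + z + exp (- z)" by (auto intro!: derivative_eq_intros)
    moreover have "0 \<le> - 1 + z + exp (- z)" using exp_ge_add_one_self[of "- z"] by simp
    ultimately show "\<exists>d. DERIV ?f z :> d \<and> 0 \<le> d" by blast
  qed
  then show ?thesis by simp
qed

lemma exp_minus_ge_cubic:
  fixes y :: real assumes "0 \<le> y" shows "1 - y + y\<^sup>2 / 2 - y ^ 3 / 6 \<le> exp (- y)"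
proof -
  let ?f = "\<lambda>y::real. exp (- y) - (1 - y + y\<^sup>2 / 2 - y ^ 3 / 6)"
  have "?f 0 \<le> ?f y"
  proof (rule DERIV_nonneg_imp_nondecreasing[OF assms])
    fix z :: real assume "0 \<le> z"
    have "DERIV ?f z :> - exp (- z) + 1 - z + z\<^sup>2 / 2"
      by (auto intro!: derivative_eq_intros simp: power2_eq_square)
    moreover have "0 \<le> - exp (- z) + 1 - z + z\<^sup>2 / 2"
      using exp_minus_le_quadratic[OF \<open>0 \<le> z\<close>] by simp
    ultimately show "\<exists>d. DERIV ?f z :> d \<and> 0 \<le> d" by blast
  qed
  then show ?thesis by simp
qed

lemma abs_diff_power2_le: "(x - t)\<^sup>2 \<le> 2 * (x\<^sup>2 + t\<^sup>2)" for x t :: real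
  using zero_le_power2[of "x + t"] by (simp add: power2_eq_square algebra_simps)

lemma abs_diff_power3_le: "\<bar>x - t\<bar> ^ 3 \<le> 4 * (\<bar>x\<bar> ^ 3 + \<bar>t\<bar> ^ 3)" for x t :: real
proof -
  have "\<bar>x - t\<bar> ^ 3 \<le> (\<bar>x\<bar> + \<bar>t\<bar>) ^ 3"
    by (intro power_mono) auto
  also have "\<dots> \<le> 4 * (\<bar>x\<bar> ^ 3 + \<bar>t\<bar> ^ 3)"
  proof -
    have "0 \<le> 3 * ((\<bar>x\<bar> + \<bar>t\<bar>) * (\<bar>x\<bar> - \<bar>t\<bar>)\<^sup>2)" by simp
    also have "\<dots> = 4 * (\<bar>x\<bar> ^ 3 + \<bar>t\<bar> ^ 3) - (\<bar>x\<bar> + \<bar>t\<bar>) ^ 3"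
      by (simp add: power2_eq_square power3_eq_cube algebra_simps)
    finally show ?thesis by simp
  qed
  finally show ?thesis .
qed

section \<open>The Fejer distribution\<close>

text \<open>
  Integration by parts reduces the Fejer kernel to the sine integral, whose limit at infinity is
  known.
\<close>

lemma DERIV_fejer_primitive:
  fixes x :: real assumes "x \<noteq> 0"
  shows "((\<lambda>x. Si x - (1 - cos x) / x) has_real_derivative (1 - cos x) / x\<^sup>2) (at x)"
  using assms
  by (auto intro!: derivative_eq_intros DERIV_Si simp: field_simps power2_eq_square)

lemma has_bochner_integral_fejer_std:
  "has_bochner_integral lborel (\<lambda>x::real. (1 - cos x) / x\<^sup>2) pi"
proof -
  let ?f = "\<lambda>x::real. (1 - cos x) / x\<^sup>2"
  let ?F = "\<lambda>x::real. Si x - (1 - cos x) / x"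
  have lim0: "(?F \<longlongrightarrow> 0) (at_right 0)"
  proof -
    have "((\<lambda>x::real. (1 - cos x) / x) \<longlongrightarrow> 0) (at_right 0)" by real_asymp
    moreover have "(Si \<longlongrightarrow> Si 0) (at_right 0)"
      using isCont_Si[of 0] by (auto simp: isCont_def intro: tendsto_within_subset)
    moreover have "Si 0 = 0" using Si_neg[of 0] by simp
    ultimately show ?thesis by (auto intro: tendsto_eq_intros)
  qed
  have limtop: "(?F \<longlongrightarrow> pi / 2) at_top"
  proof -
    have "((\<lambda>x::real. (1 - cos x) / x) \<longlongrightarrow> 0) at_top"
    proof (rule Lim_null_comparison)
      show "\<forall>\<^sub>F x in at_top. norm ((1 - cos x) / x) \<le> 2 / x" for x :: real
        using eventually_gt_at_top[of 0]
      proof eventually_elim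
        case (elim x)
        have "\<bar>1 - cos x\<bar> \<le> 2" using cos_ge_minus_one[of x] cos_le_one[of x] by linarith
        then show ?case using elim by (simp add: divide_right_mono)
      qed
      show "((\<lambda>x::real. 2 / x) \<longlongrightarrow> 0) at_top" by real_asymp
    qed
    then show ?thesis using Si_at_top by (auto intro: tendsto_eq_intros)
  qed
  have prems: "(0::ereal) < \<infinity>"
    "\<And>x. 0 < ereal x \<Longrightarrow> ereal x < \<infinity> \<Longrightarrow> DERIV ?F x :> ?f x"
    "\<And>x. 0 < ereal x \<Longrightarrow> ereal x < \<infinity> \<Longrightarrow> isCont ?f x"
    "AE x in lborel. 0 < ereal x \<longrightarrow> ereal x < \<infinity> \<longrightarrow> 0 \<le> ?f x"
    "((?F \<circ> real_of_ereal) \<longlongrightarrow> 0) (at_right 0)"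
    "((?F \<circ> real_of_ereal) \<longlongrightarrow> pi / 2) (at_left \<infinity>)"
    using lim0 limtop
    by (auto intro!: DERIV_fejer_primitive continuous_intros AE_I2 simp: zero_ereal_def ereal_tendsto_simps)
  note int = interval_integral_FTC_nonneg[OF prems]
  have "einterval 0 \<infinity> = {0::real<..}" by (auto simp: einterval_def)
  then have "has_bochner_integral lborel (\<lambda>x. indicator {0<..} x *\<^sub>R ?f x) (pi / 2)"
    using int by (simp add: has_bochner_integral_iff set_integrable_def set_lebesgue_integral_def
        interval_lebesgue_integral_0_infty zero_ereal_def[symmetric])
  then have "has_bochner_integral lborel (\<lambda>x. indicator {0..} x *\<^sub>R ?f x) (pi / 2)"
    by (rule has_bochner_integral_cong[THEN iffD1, rotated -1]) (auto split: split_indicator)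
  from has_bochner_integral_even_function[OF this] show ?thesis by simp
qed

text \<open>
  Rescaling \<open>x\<close> by \<open>b\<close>. As a function of \<open>b\<close> this says that \<open>\<bar>b\<bar>\<close> is a superposition of
  \<open>1 - cos (b x)\<close>, from which piecewise linear characteristic functions are obtained.
\<close>

lemma has_bochner_integral_fejer:
  "has_bochner_integral lborel (\<lambda>x::real. (1 - cos (b * x)) / x\<^sup>2) (pi * \<bar>b\<bar>)"
proof (cases "b = 0")
  case False
  have "has_bochner_integral lborel (\<lambda>x. (1 - cos (0 + b * x)) / (0 + b * x)\<^sup>2) (pi /\<^sub>R \<bar>b\<bar>)"
    using lborel_has_bochner_integral_real_affine_iff[of b "\<lambda>x. (1 - cos x) / x\<^sup>2" pi 0]
      has_bochner_integral_fejer_std False by simp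
  then have "has_bochner_integral lborel (\<lambda>x. b\<^sup>2 * ((1 - cos (0 + b * x)) / (0
      + b * x)\<^sup>2)) (b\<^sup>2 * (pi /\<^sub>R \<bar>b\<bar>))"
    by (intro has_bochner_integral_mult_right)
  also have "(\<lambda>x. b\<^sup>2 * ((1 - cos (0 + b * x)) / (0 + b * x)\<^sup>2)) = (\<lambda>x. (1 - cos (b * x)) / x\<^sup>2)"
    using False by (simp add: power_mult_distrib)
  also have "b\<^sup>2 * (pi /\<^sub>R \<bar>b\<bar>) = pi * \<bar>b\<bar>"
    using False by (simp add: divide_simps abs_if power2_eq_square)
  finally show ?thesis .
qed (simp add: has_bochner_integral_zero)

definition fejer_density :: "real \<Rightarrow> real" where
  "fejer_density x = (1 - cos x) / (pi * x\<^sup>2)"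

definition fejer_distribution :: "real measure" where
  "fejer_distribution = density lborel (\<lambda>x. ennreal (fejer_density x))"

lemma fejer_density_nonneg: "0 \<le> fejer_density x"
  by (simp add: fejer_density_def)

lemma measurable_fejer_density [measurable]: "fejer_density \<in> borel_measurable borel"
  unfolding fejer_density_def by measurable

text \<open>
  The product formula for cosines expresses \<open>(1 - cos x) * cos (t x)\<close> through \<open>1 - cos (b x)\<close>
  for \<open>b = 1 + t, 1 - t, t\<close>. The value is the triangle function, which is 1 at \<open>t = 0\<close> and
  vanishes for \<open>\<bar>t\<bar> \<ge> 1\<close>.
\<close>

lemma has_bochner_integral_cos_fejer_density:
  "has_bochner_integral lborel (\<lambda>x. fejer_density x * cos (t * x))
     ((\<bar>1 + t\<bar> + \<bar>1 - t\<bar>) / 2 - \<bar>t\<bar>)"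
proof -
  let ?g = "\<lambda>b x::real. (1 - cos (b * x)) / x\<^sup>2"
  have "has_bochner_integral lborel (\<lambda>x. (1 / (2 * pi)) * (?g (1 + t) x + ?g (1 - t) x - 2 * ?g t x))
      ((1 / (2 * pi)) * (pi * \<bar>1 + t\<bar> + pi * \<bar>1 - t\<bar> - 2 * (pi * \<bar>t\<bar>)))"
    by (intro has_bochner_integral_mult_right has_bochner_integral_add has_bochner_integral_diff
        has_bochner_integral_fejer) 
  also have "(\<lambda>x. (1 / (2 * pi)) * (?g (1 + t) x + ?g (1 - t) x - 2 * ?g t x)) =
      (\<lambda>x. fejer_density x * cos (t * x))"
  proof
    fix x :: real
    show "(1 / (2 * pi)) * (?g (1 + t) x + ?g (1 - t) x - 2 * ?g t x) = fejer_density x * cos (t * x)"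
      by (cases "x = 0")
        (simp_all add: fejer_density_def distrib_right left_diff_distrib cos_add cos_diff divide_simps,
         simp add: algebra_simps)
  qed
  also have "(1 / (2 * pi)) * (pi * \<bar>1 + t\<bar> + pi * \<bar>1 - t\<bar> - 2 * (pi * \<bar>t\<bar>)) =
      (\<bar>1 + t\<bar> + \<bar>1 - t\<bar>) / 2 - \<bar>t\<bar>"
    by (simp add: divide_simps) (simp add: algebra_simps)
  finally show ?thesis .
qed

lemma real_distribution_fejer: "real_distribution fejer_distribution"
proof -
  have "has_bochner_integral lborel fejer_density 1"
    using has_bochner_integral_cos_fejer_density[of 0] by simp
  then have "(\<integral>\<^sup>+x. ennreal (fejer_density x) \<partial>lborel) = 1"
    using fejer_density_nonneg by (subst nn_integral_eq_integral) (auto simp: has_bochner_integral_iff)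
  then have "emeasure fejer_distribution (space fejer_distribution) = 1"
    by (simp add: fejer_distribution_def emeasure_density)
  then have "prob_space fejer_distribution" by (rule prob_spaceI)
  then show ?thesis
    by (simp add: real_distribution_def real_distribution_axioms_def fejer_distribution_def)
qed

lemma fejer_distribution_singleton: "emeasure fejer_distribution {x} = 0"
proof -
  have "(\<integral>\<^sup>+y. ennreal (fejer_density y) * indicator {x} y \<partial>lborel) = (\<integral>\<^sup>+y. 0 \<partial>(lborel :: real measure))"
    using AE_lborel_singleton[of x] by (intro nn_integral_cong_AE) (auto elim!: eventually_mono)
  then show ?thesis by (simp add: fejer_distribution_def emeasure_density)
qed

text \<open>
  The compact support of this characteristic function is the reason for using the Fejer kernel:
  after smoothing, only the frequencies at which the sum is close to Gaussian matter. Lattice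
  laws show that high frequencies cannot be controlled otherwise.
\<close>

lemma char_fejer_eq_0:
  assumes "1 \<le> \<bar>t\<bar>" shows "char fejer_distribution t = 0"
proof -
  interpret real_distribution fejer_distribution by (rule real_distribution_fejer)
  have int: "integrable fejer_distribution (\<lambda>x. iexp (t * x))"
    by (intro integrable_iexp) auto
  have "Re (char fejer_distribution t) = (\<integral>x. cos (t * x) \<partial>fejer_distribution)"
    unfolding char_def using int by (subst integral_Re[symmetric]) (auto simp: Re_exp)
  also have "\<dots> = (\<integral>x. fejer_density x * cos (t * x) \<partial>lborel)"
    unfolding fejer_distribution_def by (subst integral_density) (auto simp: fejer_density_nonneg)
  also have "\<dots> = (\<bar>1 + t\<bar> + \<bar>1 - t\<bar>) / 2 - \<bar>t\<bar>"
    using has_bochner_integral_cos_fejer_density by (rule has_bochner_integral_integral_eq)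
  also have "\<dots> = 0" using assms by (auto simp: abs_if)
  finally have Re: "Re (char fejer_distribution t) = 0" .
  have "Im (char fejer_distribution t) = (\<integral>x. sin (t * x) \<partial>fejer_distribution)"
    unfolding char_def using int by (subst integral_Im[symmetric]) (auto simp: Im_exp)
  also have "\<dots> = (\<integral>x. fejer_density x * sin (t * x) \<partial>lborel)"
    unfolding fejer_distribution_def by (subst integral_density) (auto simp: fejer_density_nonneg)
  finally have Im_eq: "Im (char fejer_distribution t) = (\<integral>x. fejer_density x * sin (t * x) \<partial>lborel)" .
  also have "\<dots> = - (\<integral>x. fejer_density x * sin (t * x) \<partial>lborel)"
    by (subst lborel_integral_real_affine[of "-1" _ 0]) (simp_all add: fejer_density_def)
  finally have "Im (char fejer_distribution t) = - Im (char fejer_distribution t)"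
    by (simp only: Im_eq)
  then have "Im (char fejer_distribution t) = 0" by simp
  with Re show ?thesis by (simp add: complex_eq_iff)
qed

section \<open>Convolution of laws\<close>

context
  fixes F K :: "real measure"
  assumes F: "real_distribution F" and K: "real_distribution K"
begin

interpretation F: real_distribution F by (rule F)
interpretation K: real_distribution K by (rule K)
interpretation FK: pair_prob_space F K ..

lemma real_distribution_convolution: "real_distribution (F \<star> K)"
  unfolding convolution_def
  by (rule FK.real_distribution_distr) auto

lemma char_convolution: "char (F \<star> K) t = char F t * char K t"
proof -
  have "char (F \<star> K) t = (CLINT z|F \<Otimes>\<^sub>M K. iexp (t * fst z) * iexp (t * snd z))"
    unfolding char_def convolution_def
    by (subst integral_distr) (auto simp: case_prod_beta distrib_left exp_add)
  also have "\<dots> = (CLINT x|F. CLINT y|K. iexp (t * x) * iexp (t * y))"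
    by (subst FK.integral_fst'[symmetric])
      (auto intro!: FK.integrable_const_bound[where B = 1] simp: norm_mult)
  also have "\<dots> = char F t * char K t"
    by (simp add: char_def)
  finally show ?thesis .
qed

lemma cdf_convolution: "cdf (F \<star> K) x = (\<integral>y. cdf F (x - y) \<partial>K)"
proof -
  interpret C: real_distribution "F \<star> K" by (rule real_distribution_convolution)
  have "mono (cdf F)" by (intro monoI F.cdf_nondecreasing)
  then have [measurable]: "cdf F \<in> borel_measurable borel" by (rule borel_measurable_mono)
  have "emeasure (F \<star> K) {..x} = emeasure (K \<star> F) {..x}"
    by (subst convolution_commutative)
      (simp_all add: F.finite_measure_axioms K.finite_measure_axioms)
  also have "\<dots> = (\<integral>\<^sup>+y. emeasure F {a. a + y \<in> {..x}} \<partial>K)"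
    by (intro convolution_emeasure F.finite_measure_axioms K.finite_measure_axioms) auto
  also have "\<dots> = (\<integral>\<^sup>+y. ennreal (cdf F (x - y)) \<partial>K)"
    unfolding cdf_def F.emeasure_eq_measure[symmetric]
    by (intro nn_integral_cong arg_cong[where f = "emeasure F"]) auto
  finally have "cdf (F \<star> K) x = enn2real (\<integral>\<^sup>+y. ennreal (cdf F (x - y)) \<partial>K)"
    by (simp add: cdf_def measure_def)
  also have "\<dots> = (\<integral>y. cdf F (x - y) \<partial>K)"
    by (subst integral_eq_nn_integral) (auto simp: F.cdf_nonneg)
  finally show ?thesis .
qed

lemma convolution_singleton:
  assumes "\<And>x. emeasure K {x} = 0"
  shows "measure (F \<star> K) {x} = 0"
proof -
  have "emeasure (F \<star> K) {x} = (\<integral>\<^sup>+y. emeasure K {a. a + y \<in> {x}} \<partial>F)"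
    by (intro convolution_emeasure F.finite_measure_axioms K.finite_measure_axioms) auto
  also have "\<dots> = (\<integral>\<^sup>+y. emeasure K {x - y} \<partial>F)"
    by (intro nn_integral_cong arg_cong[where f = "emeasure K"]) auto
  finally show ?thesis by (simp add: assms measure_def)
qed

end

section \<open>The standard normal distribution function\<close>

text \<open>
  The constant \<open>c\<close> bounds the density on the interval up to the factor \<open>1 / sqrt (2 * pi) \<le> 1\<close>.
  With \<open>c = 1\<close> this gives a Lipschitz bound; smaller values are needed for changes of scale far
  from the origin.
\<close>

lemma cdf_std_normal_diff_le_mult:
  fixes x y c :: real
  assumes "x \<le> y" and c: "\<And>t. x < t \<Longrightarrow> t \<le> y \<Longrightarrow> exp (- t\<^sup>2 / 2) \<le> c"
  shows "cdf std_normal_distribution y - cdf std_normal_distribution x \<le> c * (y - x)"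
proof -
  interpret real_distribution std_normal_distribution by (rule real_dist_normal_dist)
  show ?thesis
  proof (cases "x = y")
    case False
    with assms(1) have "x < y" by simp
    then have c_nonneg: "0 \<le> c" using c[of y] order_trans[OF exp_ge_zero] by blast
    have "emeasure std_normal_distribution {x<..y}
        = (\<integral>\<^sup>+t. ennreal (std_normal_density t) * indicator {x<..y} t \<partial>lborel)"
      by (rule emeasure_density) measurable
    also have "\<dots> \<le> (\<integral>\<^sup>+t. ennreal c * indicator {x<..y} t \<partial>lborel)"
    proof (rule nn_integral_mono)
      fix t :: real
      show "ennreal (std_normal_density t) * indicator {x<..y} t \<le> ennreal c * indicator {x<..y} t"
      proof (cases "t \<in> {x<..y}")
        case True
        have "1 \<le> sqrt (2 * pi)" using pi_ge_two by simp
        then have "std_normal_density t \<le> exp (- t\<^sup>2 / 2)"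
          unfolding std_normal_density_def by (simp add: divide_simps)
        then have "std_normal_density t \<le> c" using c[of t] True by simp
        then show ?thesis using True by (simp add: ennreal_leI)
      qed simp
    qed
    also have "\<dots> = ennreal (c * (y - x))"
      using assms(1) c_nonneg by (subst nn_integral_cmult) (simp_all add: ennreal_mult)
    finally have "ennreal (measure std_normal_distribution {x<..y}) \<le> ennreal (c * (y - x))"
      by (simp only: emeasure_eq_measure)
    then show ?thesis
      using cdf_diff_eq[OF \<open>x < y\<close>] \<open>x < y\<close> c_nonneg by (subst (asm) ennreal_le_iff) auto
  qed simp
qed

lemma cdf_std_normal_diff_le:
  assumes "x \<le> y"
  shows "cdf std_normal_distribution y - cdf std_normal_distribution x \<le> y - x"
  using cdf_std_normal_diff_le_mult[OF assms, of 1] by simp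

lemma cdf_std_normal_lipschitz: "\<bar>cdf std_normal_distribution y - cdf std_normal_distribution x\<bar> \<le> \<bar>y - x\<bar>"
proof -
  interpret N: real_distribution std_normal_distribution by (rule real_dist_normal_dist)
  show ?thesis
    using cdf_std_normal_diff_le[of x y] cdf_std_normal_diff_le[of y x]
      N.cdf_nondecreasing[of x y] N.cdf_nondecreasing[of y x]
    by (cases "x \<le> y") auto
qed

text \<open>
  A change of scale moves the point \<open>u\<close> by \<open>(l - 1) * \<bar>u\<bar>\<close>, which is not bounded in \<open>u\<close>, but the
  density compensates for it since \<open>\<bar>u\<bar> * exp (- u\<^sup>2 / 2) \<le> 1\<close>.
\<close>

lemma cdf_std_normal_scale:
  assumes l: "1 \<le> (l :: real)"
  shows "\<bar>cdf std_normal_distribution (l * u) - cdf std_normal_distribution u\<bar> \<le> l - 1"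
proof -
  interpret N: real_distribution std_normal_distribution by (rule real_dist_normal_dist)
  let ?\<Phi> = "cdf std_normal_distribution" and ?c = "exp (- u\<^sup>2 / 2)"
  have "\<bar>?\<Phi> (l * u) - ?\<Phi> u\<bar> \<le> ?c * ((l - 1) * \<bar>u\<bar>)"
  proof (cases "0 \<le> u")
    case True
    then have "u \<le> l * u" using mult_right_mono[OF l True] by simp
    moreover have "exp (- t\<^sup>2 / 2) \<le> ?c" if "u < t" for t
      using that True by (simp add: power_mono)
    ultimately have "?\<Phi> (l * u) - ?\<Phi> u \<le> ?c * (l * u - u)"
      by (intro cdf_std_normal_diff_le_mult)
    then show ?thesis
      using N.cdf_nondecreasing[OF \<open>u \<le> l * u\<close>] True by (simp add: left_diff_distrib)
  next
    case False
    then have "l * u \<le> u" using mult_right_mono_neg[OF l, of u] by simp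
    moreover have "exp (- t\<^sup>2 / 2) \<le> ?c" if "t \<le> u" for t
    proof -
      have "\<bar>u\<bar> \<le> \<bar>t\<bar>" using that False by simp
      then show ?thesis by (simp add: abs_le_square_iff)
    qed
    ultimately have "?\<Phi> u - ?\<Phi> (l * u) \<le> ?c * (u - l * u)"
      by (intro cdf_std_normal_diff_le_mult)
    then show ?thesis
      using N.cdf_nondecreasing[OF \<open>l * u \<le> u\<close>] False by (simp add: left_diff_distrib)
  qed
  also have "\<dots> = (l - 1) * (\<bar>u\<bar> / exp (u\<^sup>2 / 2))"
    using exp_minus_inverse[of "u\<^sup>2 / 2"] by (simp add: field_simps)
  also have "\<dots> \<le> (l - 1) * 1"
  proof (rule mult_left_mono)
    have "0 \<le> (\<bar>u\<bar> - 1)\<^sup>2" by simp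
    then have "\<bar>u\<bar> \<le> 1 + u\<^sup>2 / 2" by (simp add: power2_diff)
    also have "\<dots> \<le> exp (u\<^sup>2 / 2)" by (rule exp_ge_add_one_self)
    finally show "\<bar>u\<bar> / exp (u\<^sup>2 / 2) \<le> 1" by simp
  qed (use l in simp)
  finally show ?thesis by simp
qed

lemma cdf_std_normal_divide:
  assumes s: "0 < (s :: real)" and s2: "1 / 2 \<le> s\<^sup>2"
  shows "\<bar>cdf std_normal_distribution (y / s) - cdf std_normal_distribution y\<bar> \<le> 2 * \<bar>s\<^sup>2 - 1\<bar>"
proof (cases "1 \<le> s")
  case True
  have "\<bar>cdf std_normal_distribution (y / s) - cdf std_normal_distribution y\<bar> \<le> s - 1"
    using cdf_std_normal_scale[OF True, of "y / s"] s by (simp add: abs_minus_commute)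
  also have "s - 1 \<le> s\<^sup>2 - 1" using mult_right_mono[OF True, of s] s by (simp add: power2_eq_square)
  finally show ?thesis by simp
next
  case False
  then have "1 \<le> 1 / s" using s by simp
  then have "\<bar>cdf std_normal_distribution (y / s) - cdf std_normal_distribution y\<bar> \<le> 1 / s - 1"
    using cdf_std_normal_scale[of "1 / s" y] by simp
  also have "\<dots> = (1 - s\<^sup>2) / (s + s\<^sup>2)"
  proof -
    have "(1 - s\<^sup>2) / (s + s\<^sup>2) = ((1 - s) * (1 + s)) / (s * (1 + s))"
      by (simp add: power2_eq_square algebra_simps)
    also have "\<dots> = (1 - s) / s" using s by simp
    finally show ?thesis using s by (simp add: diff_divide_distrib)
  qed
  also have "\<dots> \<le> (1 - s\<^sup>2) / (1 / 2)"
  proof (rule divide_left_mono)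
    show "0 \<le> 1 - s\<^sup>2" using False s by (simp add: abs_square_le_1)
    show "1 / 2 \<le> s + s\<^sup>2" using s s2 by simp
    then show "0 < (s + s\<^sup>2) * (1 / 2)" by simp
  qed
  also have "\<dots> \<le> 2 * \<bar>s\<^sup>2 - 1\<bar>" using abs_ge_minus_self[of "s\<^sup>2 - 1"] by simp
  finally show ?thesis .
qed

lemma std_normal_tails:
  assumes c: "0 < c"
  shows "cdf std_normal_distribution (- c) \<le> 1 / c\<^sup>2" "1 - cdf std_normal_distribution c \<le> 1 / c\<^sup>2"
proof -
  interpret N: real_distribution std_normal_distribution by (rule real_dist_normal_dist)
  let ?T = "{x. c \<le> \<bar>x - 0\<bar>}"
  have "N.expectation (\<lambda>x. x) = 0"
    using integral_std_normal_distribution_moment_odd[of 1] by simp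
  moreover have "N.expectation (\<lambda>x. x\<^sup>2) = 1" "integrable std_normal_distribution (\<lambda>x. x\<^sup>2)"
    using std_normal_distribution_even_moments[of 1] by simp_all
  ultimately have tail: "measure std_normal_distribution ?T \<le> 1 / c\<^sup>2"
    using N.Chebyshev_inequality[of "\<lambda>x. x" c] c by simp
  have "cdf std_normal_distribution (- c) \<le> measure std_normal_distribution ?T"
    unfolding cdf_def by (intro N.finite_measure_mono) auto
  with tail show "cdf std_normal_distribution (- c) \<le> 1 / c\<^sup>2" by linarith
  have "1 - cdf std_normal_distribution c
      = measure std_normal_distribution (space std_normal_distribution - {..c})"
    unfolding cdf_def by (subst N.prob_compl) auto
  also have "\<dots> \<le> measure std_normal_distribution ?T"
    by (intro N.finite_measure_mono) auto
  finally show "1 - cdf std_normal_distribution c \<le> 1 / c\<^sup>2" using tail by linarith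
qed

section \<open>From characteristic functions to distribution functions\<close>

lemma norm_iexp_diff_le_2: "norm (iexp a - iexp b) \<le> 2"
  by (rule order_trans[OF norm_triangle_ineq4]) simp

text \<open>
  Subtract the Levy inversion formulas for an interval \<open>(a, b]\<close>. Its kernel is bounded by
  \<open>2 / \<bar>t\<bar>\<close> whatever \<open>a\<close> is, and the factor \<open>\<bar>t\<bar>\<close> in the hypothesis makes the integrand bounded
  by \<open>2 * q t\<close>; then let \<open>a\<close> tend to minus infinity.
\<close>

lemma cdf_diff_le_char_diff:
  assumes F: "real_distribution F" and G: "real_distribution G"
    and F0: "\<And>x. measure F {x} = 0" and G0: "\<And>x. measure G {x} = 0"
    and q: "integrable lborel q" and le: "\<And>t. cmod (char F t - char G t) \<le> \<bar>t\<bar> * q t"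
  shows "\<bar>cdf F b - cdf G b\<bar> \<le> (\<integral>t. q t \<partial>lborel) / pi"
proof -
  interpret F: real_distribution F by (rule F)
  interpret G: real_distribution G by (rule G)
  have q_nonneg: "0 \<le> q t" if "t \<noteq> 0" for t
    using order_trans[OF norm_ge_zero le[of t]] that by (simp add: zero_le_mult_iff)
  have Ioc: "\<bar>measure F {a<..b} - measure G {a<..b}\<bar> \<le> (\<integral>t. q t \<partial>lborel) / pi" if "a < b" for a b
  proof (rule LIMSEQ_le_const2)
    define e where "e t = (iexp (-(t * a)) - iexp (-(t * b))) / (\<i> * t)" for t :: real
    let ?I = "\<lambda>H (T::nat). 1 / (2 * pi) * (CLBINT t=-real T..real T. e t * char H t)"
    have "?I F \<longlonglongrightarrow> complex_of_real (measure F {a<..b})"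
      using F.Levy_Inversion[of a b] \<open>a < b\<close> F0 by (simp add: e_def)
    moreover have "?I G \<longlonglongrightarrow> complex_of_real (measure G {a<..b})"
      using G.Levy_Inversion[of a b] \<open>a < b\<close> G0 by (simp add: e_def)
    ultimately have "(\<lambda>T. norm (?I F T - ?I G T)) \<longlonglongrightarrow> norm (complex_of_real (measure F {a<..b})
        - measure G {a<..b})"
      by (intro tendsto_norm tendsto_diff)
    also have "norm (complex_of_real (measure F {a<..b}) - measure G {a<..b})
        = \<bar>measure F {a<..b} - measure G {a<..b}\<bar>"
      by (metis norm_of_real of_real_diff real_norm_def)
    finally show "(\<lambda>T. norm (?I F T - ?I G T)) \<longlonglongrightarrow> \<bar>measure F {a<..b} - measure G {a<..b}\<bar>" .
    (* Unlike 2 / |t|, this bound is finite at the origin; it gives integrability. *)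
    have e_bound: "norm (e t) \<le> b - a" if "t \<noteq> 0" for t
    proof -
      have "norm (e t) = norm (iexp (t * (-a)) - iexp (t * (-b))) / \<bar>t\<bar>"
        by (simp add: e_def norm_divide norm_mult)
      then show ?thesis
        using Levy_Inversion_aux2[of "-b" "-a" t] that \<open>a < b\<close> by (simp add: norm_divide norm_mult)
    qed
    have e_int: "complex_interval_lebesgue_integrable lborel (-real T) (real T) (\<lambda>t. e t * char H t)"
      if "real_distribution H" for T :: nat and H
    proof -
      interpret H: real_distribution H by (rule that)
      have bd: "norm (e t * char H t) \<le> b - a" if "t \<noteq> 0" for t
        using mult_mono[OF e_bound[OF that] H.cmod_char_le_1[of t]] \<open>a < b\<close> by (simp add: norm_mult)
      have "AE t in lborel. t \<in> einterval (- real T) (real T) \<longrightarrow> norm (e t * char H t) \<le> b - a"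
        using AE_lborel_singleton[of "0::real"] by eventually_elim (simp add: bd)
      moreover have "(\<lambda>t. e t * char H t) \<in> borel_measurable lborel"
        unfolding e_def by measurable
      ultimately have "complex_integrable lborel (\<lambda>t. indicator (einterval (- real T) (real T)) t *\<^sub>R (e t * char H t))"
        by (intro integrableI_bounded_set_indicator[where B="b - a"]) auto
      then show ?thesis
        by (simp add: interval_lebesgue_integrable_def set_integrable_def)
    qed
    show "\<exists>N. \<forall>T\<ge>N. norm (?I F T - ?I G T) \<le> (\<integral>t. q t \<partial>lborel) / pi"
    proof (intro exI allI impI)
      fix T :: nat
      let ?A = "einterval (- real T) (real T)"
      have "?I F T - ?I G T = 1 / (2 * pi) * (CLBINT t=-real T..real T. e t * (char F t - char G t))"
        using interval_lebesgue_integral_diff(2)[OF e_int[OF F] e_int[OF G], of T]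
        by (simp add: right_diff_distrib)
      also have "norm \<dots> = 1 / (2 * pi) * norm (CLBINT t. indicator ?A t *\<^sub>R (e t * (char F t - char G t)))"
        by (simp add: norm_mult norm_divide interval_lebesgue_integral_def set_lebesgue_integral_def)
      finally have eq: "norm (?I F T - ?I G T)
          = 1 / (2 * pi) * norm (CLBINT t. indicator ?A t *\<^sub>R (e t * (char F t - char G t)))" .
      have "norm (CLBINT t. indicator ?A t *\<^sub>R (e t * (char F t - char G t))) \<le> (\<integral>t. 2 * q t \<partial>lborel)"
      proof (rule order_trans[OF integral_norm_bound integral_mono_AE[OF integrable_norm]])
        show "complex_integrable lborel (\<lambda>t. indicator ?A t *\<^sub>R (e t * (char F t - char G t)))"
          using interval_lebesgue_integral_diff(1)[OF e_int[OF F] e_int[OF G], of T]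
          by (simp add: right_diff_distrib interval_lebesgue_integrable_def set_integrable_def)
        show "integrable lborel (\<lambda>t. 2 * q t)" using q by simp
        show "AE t in lborel. norm (indicator ?A t *\<^sub>R (e t * (char F t - char G t))) \<le> 2 * q t"
          using AE_lborel_singleton[of "0::real"]
        proof eventually_elim
          case (elim t)
          have "norm (e t * (char F t - char G t)) \<le> 2 / \<bar>t\<bar> * (\<bar>t\<bar> * q t)"
            unfolding norm_mult
          proof (intro mult_mono le)
            show "norm (e t) \<le> 2 / \<bar>t\<bar>"
              using divide_right_mono[OF norm_iexp_diff_le_2[of "-(t * a)" "-(t * b)"], of "\<bar>t\<bar>"]
              by (simp add: e_def norm_divide norm_mult)
          qed auto
          then show ?case using elim q_nonneg[of t] by (auto split: split_indicator)
        qed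
      qed
      then have "norm (?I F T - ?I G T) \<le> 1 / (2 * pi) * (\<integral>t. 2 * q t \<partial>lborel)"
        unfolding eq by (rule mult_left_mono) simp
      then show "norm (?I F T - ?I G T) \<le> (\<integral>t. q t \<partial>lborel) / pi"
        by (simp only: integral_mult_right_zero) simp
    qed
  qed
  have "((\<lambda>a. \<bar>(cdf F b - cdf F a) - (cdf G b - cdf G a)\<bar>) \<longlongrightarrow> \<bar>(cdf F b - 0) - (cdf G b - 0)\<bar>) at_bot"
    by (intro tendsto_intros F.cdf_lim_at_bot G.cdf_lim_at_bot)
  then have "\<bar>(cdf F b - 0) - (cdf G b - 0)\<bar> \<le> (\<integral>t. q t \<partial>lborel) / pi"
  proof (rule tendsto_upperbound)
    show "\<forall>\<^sub>F a in at_bot. \<bar>(cdf F b - cdf F a) - (cdf G b - cdf G a)\<bar> \<le> (\<integral>t. q t \<partial>lborel) / pi"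
      using eventually_gt_at_bot[of b] by eventually_elim (simp add: F.cdf_diff_eq G.cdf_diff_eq Ioc)
  qed simp
  then show ?thesis by simp
qed

text \<open>
  Let \<open>\<eta>\<close> be the supremum of the difference \<open>d\<close> to be bounded. A value \<open>d x\<close> persists, up to
  \<open>2 * h\<close>, on an interval of length \<open>2 * h\<close> to the right of \<open>x\<close> if it is positive and to the
  left if it is negative, because one distribution function is monotone and the other one
  Lipschitz. Averaging with \<open>K\<close> around the midpoint of this interval nearly preserves the value:
  the mass of \<open>K\<close> outside it is at most \<open>1 / 4\<close> and loses at most \<open>2 * \<eta>\<close> times that. So
  \<open>\<eta> \<le> \<delta> + 2 * h + \<eta> / 2\<close>.
\<close>

lemma smoothing_inequality:
  assumes F: "real_distribution F" and K: "real_distribution K" and h: "0 \<le> h"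
    and tail: "measure K {y. h < \<bar>y\<bar>} \<le> 1 / 4"
    and \<delta>: "\<And>x. \<bar>cdf (F \<star> K) x - cdf (std_normal_distribution \<star> K) x\<bar> \<le> \<delta>"
  shows "\<bar>cdf F x - cdf std_normal_distribution x\<bar> \<le> 2 * \<delta> + 4 * h"
proof -
  interpret F: real_distribution F by (rule F)
  interpret K: real_distribution K by (rule K)
  interpret N: real_distribution std_normal_distribution by (rule real_dist_normal_dist)
  let ?\<Phi> = "cdf std_normal_distribution"
  define d where "d x = cdf F x - ?\<Phi> x" for x
  define \<eta> where "\<eta> = (SUP x. \<bar>d x\<bar>)"
  have "\<bar>d x\<bar> \<le> 1" for x
    using F.cdf_nonneg[of x] F.cdf_bounded_prob[of x] N.cdf_nonneg[of x] N.cdf_bounded_prob[of x]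
    by (simp add: d_def)
  then have bdd: "bdd_above (range (\<lambda>x. \<bar>d x\<bar>))" by (auto intro!: bdd_aboveI)
  have \<eta>: "\<bar>d x\<bar> \<le> \<eta>" for x unfolding \<eta>_def by (rule cSUP_upper[OF _ bdd]) simp
  have meas [measurable]: "cdf F \<in> borel_measurable borel" "?\<Phi> \<in> borel_measurable borel"
    by (auto intro!: borel_measurable_mono monoI F.cdf_nondecreasing N.cdf_nondecreasing)
  have int: "integrable K (\<lambda>y. cdf F (x - y))" "integrable K (\<lambda>y. ?\<Phi> (x - y))" for x
    using F.cdf_nonneg F.cdf_bounded_prob N.cdf_nonneg N.cdf_bounded_prob
    by (auto intro!: K.integrable_const_bound[where B = 1])
  have \<delta>': "\<bar>\<integral>y. d (x - y) \<partial>K\<bar> \<le> \<delta>" for x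
    using \<delta>[of x] int[of x] unfolding d_def
    by (simp add: cdf_convolution[OF F K] cdf_convolution[OF real_dist_normal_dist K])
  have d_int: "integrable K (\<lambda>y. d (x - y))" for x
    using int unfolding d_def by auto
  let ?B = "{y. h < \<bar>y\<bar>}"
  have "integrable K (indicator ?B :: real \<Rightarrow> real)"
    by (intro K.integrable_const_bound[where B = 1]) auto
  note ind_int = integrable_mult_right[OF this, of "2 * \<eta>"]
  have B_int: "integrable K (\<lambda>y. c - 2 * \<eta> * indicator ?B y)" for c :: real
    by (intro Bochner_Integration.integrable_diff K.integrable_const ind_int)
  have B_val: "(\<integral>y. c - 2 * \<eta> * indicator ?B y \<partial>K) \<ge> c - \<eta> / 2" for c
  proof -
    have "(\<integral>y. c - 2 * \<eta> * indicator ?B y \<partial>K) = c - 2 * \<eta> * measure K ?B"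
      by (subst Bochner_Integration.integral_diff[OF K.integrable_const ind_int])
        (simp add: K.prob_space[unfolded K.space_eq_univ])
    moreover have "2 * \<eta> * measure K ?B \<le> 2 * \<eta> * (1 / 4)"
      using tail \<eta>[of 0] by (intro mult_left_mono) auto
    ultimately show ?thesis by simp
  qed
  have upper: "d x \<le> \<delta> + 2 * h + \<eta> / 2" for x
  proof -
    have "d x - 2 * h - \<eta> / 2 \<le> (\<integral>y. (d x - 2 * h) - 2 * \<eta> * indicator ?B y \<partial>K)"
      by (rule B_val)
    (* Centred at x + h, the arguments with |y| <= h lie to the right of x. *)
    also have "\<dots> \<le> (\<integral>y. d (x + h - y) \<partial>K)"
    proof (intro integral_mono B_int d_int)
      fix y
      show "(d x - 2 * h) - 2 * \<eta> * indicator ?B y \<le> d (x + h - y)"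
      proof (cases "h < \<bar>y\<bar>")
        case True
        then show ?thesis using \<eta>[of x] \<eta>[of "x + h - y"] h by auto
      next
        case False
        then have "- h \<le> y" "y \<le> h" by auto
        then show ?thesis
          using F.cdf_nondecreasing[of x "x + h - y"] cdf_std_normal_diff_le[of x "x + h - y"]
          by (auto simp: d_def)
      qed
    qed
    also have "\<dots> \<le> \<delta>" using \<delta>'[of "x + h"] by simp
    finally show ?thesis by simp
  qed
  have lower: "- d x \<le> \<delta> + 2 * h + \<eta> / 2" for x
  proof -
    have "- d x - 2 * h - \<eta> / 2 \<le> (\<integral>y. (- d x - 2 * h) - 2 * \<eta> * indicator ?B y \<partial>K)"
      by (rule B_val)
    (* Centred at x - h, the arguments with |y| <= h lie to the left of x. *)
    also have "\<dots> \<le> (\<integral>y. - d (x - h - y) \<partial>K)"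
    proof (intro integral_mono B_int Bochner_Integration.integrable_minus d_int)
      fix y
      show "(- d x - 2 * h) - 2 * \<eta> * indicator ?B y \<le> - d (x - h - y)"
      proof (cases "h < \<bar>y\<bar>")
        case True
        then show ?thesis using \<eta>[of x] \<eta>[of "x - h - y"] h by auto
      next
        case False
        then have "- h \<le> y" "y \<le> h" by auto
        then show ?thesis
          using F.cdf_nondecreasing[of "x - h - y" x] cdf_std_normal_diff_le[of "x - h - y" x]
          by (auto simp: d_def)
      qed
    qed
    also have "\<dots> \<le> \<delta>" using \<delta>'[of "x - h"] by simp
    finally show ?thesis by simp
  qed
  have "\<eta> \<le> \<delta> + 2 * h + \<eta> / 2"
    unfolding \<eta>_def using upper lower by (intro cSUP_least) (auto simp: \<eta>_def abs_le_iff)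
  then show ?thesis using \<eta>[of x] by (simp add: d_def)
qed

lemma exists_tail_le:
  assumes "real_distribution K"
  obtains h where "0 \<le> h" "measure K {y. h < \<bar>y\<bar>} \<le> 1 / 4"
proof -
  interpret real_distribution K by fact
  have "(\<lambda>k::nat. measure K {y. real k < \<bar>y\<bar>}) \<longlonglongrightarrow> measure K (\<Inter>k. {y. real k < \<bar>y\<bar>})"
    by (rule finite_Lim_measure_decseq) (auto simp: decseq_def)
  also have "(\<Inter>k::nat. {y. real k < \<bar>y\<bar>}) = {}"
  proof -
    have "\<exists>k::nat. \<bar>y\<bar> \<le> real k" for y :: real by (rule real_arch_simple)
    then show ?thesis by (auto simp: not_less[symmetric])
  qed
  finally have "\<forall>\<^sub>F k::nat in sequentially. measure K {y. real k < \<bar>y\<bar>} < 1 / 4"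
    by (rule order_tendstoD) simp
  then obtain k :: nat where "measure K {y. real k < \<bar>y\<bar>} < 1 / 4"
    by (auto simp: eventually_sequentially)
  then show ?thesis by (intro that[of "real k"]) auto
qed

section \<open>Characteristic functions of standardised sums\<close>

locale standardized_law = real_distribution \<nu> for \<nu> :: "real measure" +
  assumes integrable_sq: "integrable \<nu> (\<lambda>x. x\<^sup>2)"
    and mean_0: "(\<integral>x. x \<partial>\<nu>) = 0"
    and variance_1: "(\<integral>x. x\<^sup>2 \<partial>\<nu>) = 1"
begin

lemma integrable_id: "integrable \<nu> (\<lambda>x. x)"
  by (rule square_integrable_imp_integrable[OF _ integrable_sq]) simp

end

text \<open>
  The third moment is kept out of \<open>standardized_law\<close> because the law of the observations need
  not have one; the law of the truncated summands does.
\<close>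

locale standardized_law_third_moment = standardized_law +
  assumes integrable_abs3: "integrable \<nu> (\<lambda>x. \<bar>x\<bar> ^ 3)"
begin

definition \<rho> :: real where "\<rho> = (\<integral>x. \<bar>x\<bar> ^ 3 \<partial>\<nu>)"

text \<open>
  The polynomial inequality \<open>(3 x\<^sup>2 - 1) / 2 \<le> \<bar>x\<bar>\<^sup>3\<close> takes the place of an appeal to Jensen's
  inequality.
\<close>

lemma \<rho>_ge_1: "1 \<le> \<rho>"
proof -
  have "(\<integral>x. (3 * x\<^sup>2 - 1) / 2 \<partial>\<nu>) \<le> \<rho>"
    unfolding \<rho>_def
  proof (rule integral_mono)
    show "integrable \<nu> (\<lambda>x. (3 * x\<^sup>2 - 1) / 2)" using integrable_sq by auto
    fix x :: real
    have "0 \<le> (\<bar>x\<bar> - 1)\<^sup>2 * (2 * \<bar>x\<bar> + 1)" by simp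
    also have "\<dots> = 2 * \<bar>x\<bar> ^ 3 - 3 * \<bar>x\<bar>\<^sup>2 + 1"
      by (simp add: algebra_simps power2_eq_square power3_eq_cube)
    finally show "(3 * x\<^sup>2 - 1) / 2 \<le> \<bar>x\<bar> ^ 3" by simp
  qed (rule integrable_abs3)
  moreover have "(\<integral>x. (3 * x\<^sup>2 - 1) / 2 \<partial>\<nu>) = 1"
    using integrable_sq by (simp add: variance_1 prob_space[unfolded space_eq_univ])
  ultimately show ?thesis by simp
qed

lemma char_taylor: "cmod (char \<nu> u - (1 - u\<^sup>2 / 2)) \<le> \<bar>u\<bar> ^ 3 * \<rho> / 6"
proof -
  have "cmod (char \<nu> u - (1 - u\<^sup>2 * 1 / 2)) \<le> u\<^sup>2 / 6 * (\<integral>x. min (6 * x\<^sup>2) (\<bar>u\<bar> * \<bar>x\<bar> ^ 3) \<partial>\<nu>)"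
    using integrable_id integrable_sq by (intro char_approx3) (auto simp: mean_0 variance_1)
  also have "\<dots> \<le> u\<^sup>2 / 6 * (\<integral>x. \<bar>u\<bar> * \<bar>x\<bar> ^ 3 \<partial>\<nu>)"
    using integrable_sq integrable_abs3
    by (intro mult_left_mono integral_mono) (auto intro!: integrable_min)
  also have "\<dots> = \<bar>u\<bar> ^ 3 * \<rho> / 6"
    by (simp add: \<rho>_def power3_eq_cube power2_eq_square abs_mult_self_eq)
  finally show ?thesis by simp
qed

text \<open>
  In the range \<open>\<bar>u\<bar> \<le> 1 / \<rho>\<close> the cubic Taylor remainder is at most \<open>u\<^sup>2 / 6\<close>, a third of the
  quadratic term, so that some Gaussian decay survives.
\<close>

lemma char_near_gaussian:
  assumes u: "\<bar>u\<bar> \<le> 1 / \<rho>"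
  shows "cmod (char \<nu> u - exp (- u\<^sup>2 / 2)) \<le> \<bar>u\<bar> ^ 3 * \<rho>"
    and "cmod (char \<nu> u) \<le> exp (- u\<^sup>2 / 3)"
proof -
  have u\<rho>: "\<bar>u\<bar> * \<rho> \<le> 1" using u \<rho>_ge_1 by (simp add: field_simps)
  have u1: "\<bar>u\<bar> \<le> 1" using u \<rho>_ge_1 by (intro order_trans[OF u]) simp
  have u2: "u\<^sup>2 \<le> 1" using u1 by (simp add: abs_square_le_1)
  have "\<bar>exp (- (u\<^sup>2 / 2)) - (1 - u\<^sup>2 / 2)\<bar> \<le> (u\<^sup>2 / 2)\<^sup>2 / 2"
    using exp_minus_le_quadratic[of "u\<^sup>2 / 2"] exp_ge_add_one_self[of "- (u\<^sup>2 / 2)"] by auto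
  also have "\<dots> = \<bar>u\<bar> ^ 3 * \<bar>u\<bar> / 8"
    by (simp add: power2_eq_square power3_eq_cube abs_mult_self_eq mult.assoc)
  also have "\<dots> \<le> \<bar>u\<bar> ^ 3 * \<rho> / 8"
    using u1 \<rho>_ge_1 by (intro divide_right_mono mult_left_mono) auto
  finally have e: "\<bar>exp (- (u\<^sup>2 / 2)) - (1 - u\<^sup>2 / 2)\<bar> \<le> \<bar>u\<bar> ^ 3 * \<rho> / 8" .
  have "cmod (char \<nu> u - exp (- u\<^sup>2 / 2))
      = cmod ((char \<nu> u - (1 - u\<^sup>2 / 2)) - of_real (exp (- (u\<^sup>2 / 2)) - (1 - u\<^sup>2 / 2)))"
    by simp
  also have "\<dots> \<le> \<bar>u\<bar> ^ 3 * \<rho> / 6 + \<bar>u\<bar> ^ 3 * \<rho> / 8"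
    using e by (intro order_trans[OF norm_triangle_ineq4] add_mono char_taylor) (simp only: norm_of_real)
  also have "\<dots> \<le> \<bar>u\<bar> ^ 3 * \<rho>"
    using \<rho>_ge_1 by (simp add: field_simps)
  finally show "cmod (char \<nu> u - exp (- u\<^sup>2 / 2)) \<le> \<bar>u\<bar> ^ 3 * \<rho>" .
  have "cmod (char \<nu> u) \<le> cmod (char \<nu> u - (1 - u\<^sup>2 / 2)) + cmod (of_real (1 - u\<^sup>2 / 2))"
    using norm_triangle_ineq[of "char \<nu> u - (1 - u\<^sup>2 / 2)" "of_real (1 - u\<^sup>2 / 2)"] by simp
  also have "\<dots> \<le> u\<^sup>2 / 6 + (1 - u\<^sup>2 / 2)"
  proof (rule add_mono)
    have "\<bar>u\<bar> ^ 3 * \<rho> = u\<^sup>2 * (\<bar>u\<bar> * \<rho>)" by (simp add: power3_eq_cube power2_eq_square)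
    also have "\<dots> \<le> u\<^sup>2" using mult_left_mono[OF u\<rho>, of "u\<^sup>2"] by simp
    finally show "cmod (char \<nu> u - (1 - u\<^sup>2 / 2)) \<le> u\<^sup>2 / 6"
      using char_taylor[of u] by simp
    show "cmod (of_real (1 - u\<^sup>2 / 2)) \<le> 1 - u\<^sup>2 / 2"
      using u2 by (simp only: norm_of_real)
  qed
  also have "\<dots> = 1 + (- u\<^sup>2 / 3)" by simp
  also have "\<dots> \<le> exp (- u\<^sup>2 / 3)" by (rule exp_ge_add_one_self)
  finally show "cmod (char \<nu> u) \<le> exp (- u\<^sup>2 / 3)" .
qed

text \<open>
  Compare the \<open>n\<close>-th powers of the characteristic function and of \<open>exp (- u\<^sup>2 / 2)\<close> at
  \<open>u = t / sqrt n\<close>. Of the \<open>n\<close> factors \<open>exp (- u\<^sup>2 / 3)\<close> one is lost; for \<open>n \<ge> 2\<close> at least half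
  of them remain, which yields the exponent \<open>- t\<^sup>2 / 6\<close>.
\<close>

lemma char_sum_near_gaussian:
  assumes n: "2 \<le> n" and t: "\<bar>t\<bar> \<le> sqrt (real n) / \<rho>"
  shows "cmod (char \<nu> (t / sqrt (real n)) ^ n - exp (- t\<^sup>2 / 2))
      \<le> \<bar>t\<bar> ^ 3 * \<rho> / sqrt (real n) * exp (- t\<^sup>2 / 6)"
proof -
  let ?s = "sqrt (real n)" and ?u = "t / sqrt (real n)"
  have s: "0 < ?s" using n by simp
  have s2: "?s * ?s = real n" by simp
  have u: "\<bar>?u\<bar> \<le> 1 / \<rho>" using t s by (simp add: field_simps)
  have u2: "?u\<^sup>2 = t\<^sup>2 / real n" by (simp add: power_divide)
  have "exp (- t\<^sup>2 / 2) = exp (- ?u\<^sup>2 / 2) ^ n"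
    using n by (simp add: u2 exp_of_nat_mult[symmetric])
  then have "cmod (char \<nu> ?u ^ n - exp (- t\<^sup>2 / 2)) = cmod (char \<nu> ?u ^ n - of_real (exp (- ?u\<^sup>2 / 2)) ^ n)"
    by simp
  also have "\<dots> \<le> real n * cmod (char \<nu> ?u - of_real (exp (- ?u\<^sup>2 / 2))) * exp (- ?u\<^sup>2 / 3) ^ (n - 1)"
    using n char_near_gaussian(2)[OF u]
    by (intro norm_power_diff_scaled) (auto simp del: of_real_exp simp: norm_of_real)
  also have "\<dots> \<le> real n * (\<bar>?u\<bar> ^ 3 * \<rho>) * exp (- t\<^sup>2 / 6)"
  proof (intro mult_mono)
    show "cmod (char \<nu> ?u - of_real (exp (- ?u\<^sup>2 / 2))) \<le> \<bar>?u\<bar> ^ 3 * \<rho>"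
      by (rule char_near_gaussian(1)[OF u])
    have "exp (- ?u\<^sup>2 / 3) ^ (n - 1) = exp (- (real (n - 1) / real n) * t\<^sup>2 / 3)"
      by (simp add: u2 exp_of_nat_mult[symmetric])
    also have "\<dots> \<le> exp (- (1 / 2) * t\<^sup>2 / 3)"
    proof -
      have "1 / 2 \<le> real (n - 1) / real n" using n by (simp add: field_simps of_nat_diff)
      from mult_right_mono[OF this, of "t\<^sup>2 / 3"]
      have "t\<^sup>2 / 6 \<le> real (n - 1) / real n * t\<^sup>2 / 3" by simp
      then show ?thesis by (simp only: exp_le_cancel_iff)
    qed
    finally show "exp (- ?u\<^sup>2 / 3) ^ (n - 1) \<le> exp (- t\<^sup>2 / 6)" by simp
  qed (use \<rho>_ge_1 in auto)
  also have "real n * (\<bar>?u\<bar> ^ 3 * \<rho>) = ?s * ?s * (\<bar>t\<bar> ^ 3 / ?s ^ 3 * \<rho>)"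
    by (simp add: power_divide)
  also have "\<dots> = \<bar>t\<bar> ^ 3 * \<rho> / ?s"
    using s by (simp add: power3_eq_cube del: real_sqrt_mult_self)
  finally show ?thesis .
qed

end

section \<open>The Berry-Esseen theorem\<close>

lemma integrable_gaussian_sq: "integrable lborel (\<lambda>t::real. t\<^sup>2 * exp (- t\<^sup>2 / 6))"
proof -
  have "integrable lborel (\<lambda>t. sqrt (2 * pi * (sqrt 3)\<^sup>2) * (normal_density 0 (sqrt 3) t * (t - 0) ^ 2))"
    by (intro integrable_mult_right integrable_normal_moment) simp
  then show ?thesis
    by (rule Bochner_Integration.integrable_cong[THEN iffD1, rotated -1]) (auto simp: normal_density_def)
qed

text \<open>
  Write \<open>l = \<rho> / sqrt n\<close>. The Gaussian comparison holds for frequencies up to \<open>1 / l\<close>, so the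
  Fejer law is scaled by \<open>l\<close> in order that its characteristic function vanishes beyond. Both the
  integral of the difference of the characteristic functions and the width of the kernel are
  then of order \<open>l\<close>.
\<close>

lemma exists_berry_esseen_constant:
  obtains C where "0 < C" 
    "\<And>\<nu> F n x. \<lbrakk>standardized_law_third_moment \<nu>; real_distribution F; n \<ge> 1;
       \<And>t. char F t = char \<nu> (t / sqrt (real n)) ^ n\<rbrakk> \<Longrightarrow>
       \<bar>cdf F x - cdf std_normal_distribution x\<bar> \<le> C * (\<integral>x. \<bar>x\<bar> ^ 3 \<partial>\<nu>) / sqrt (real n)"
proof -
  interpret K: real_distribution fejer_distribution by (rule real_distribution_fejer)
  obtain h where h: "0 \<le> h" "measure fejer_distribution {y. h < \<bar>y\<bar>} \<le> 1 / 4"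
    using exists_tail_le[OF real_distribution_fejer] by blast
  define J where "J = integral\<^sup>L lborel (\<lambda>t::real. t\<^sup>2 * exp (- t\<^sup>2 / 6))"
  define C where "C = 2 * J / pi + 4 * h + 1"
  have J: "0 \<le> J" unfolding J_def by (rule integral_nonneg_AE) simp
  then have C1: "1 \<le> C" using h by (simp add: C_def)
  show ?thesis
  proof (rule that[of C])
    show "0 < C" using C1 by simp
    fix \<nu> F n x
    assume "standardized_law_third_moment \<nu>" and F: "real_distribution F" and n: "(n::nat) \<ge> 1"
      and char_F: "\<And>t. char F t = char \<nu> (t / sqrt (real n)) ^ n"
    interpret standardized_law_third_moment \<nu> by fact
    interpret F: real_distribution F by fact
    interpret N: real_distribution std_normal_distribution by (rule real_dist_normal_dist)
    define l where "l = \<rho> / sqrt (real n)"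
    have l: "0 < l" using \<rho>_ge_1 n by (simp add: l_def)
    have "\<bar>cdf F x - cdf std_normal_distribution x\<bar> \<le> C * l"
    (* For n = 1 the comparison of powers gives no decay, but then l >= 1 and the bound is trivial. *)
    proof (cases "n = 1")
      case True
      then have "1 \<le> l" using \<rho>_ge_1 by (simp add: l_def)
      then have "1 * 1 \<le> C * l" using C1 by (intro mult_mono) auto
      then show ?thesis
        using F.cdf_nonneg[of x] F.cdf_bounded_prob[of x] N.cdf_nonneg[of x] N.cdf_bounded_prob[of x]
        by simp
    next
      case False
      then have n2: "2 \<le> n" using n by simp
      let ?K = "distr fejer_distribution borel (\<lambda>x. l * x)"
      have K: "real_distribution ?K" by simp
      have char_K: "char ?K t = char fejer_distribution (t * l)" for t
        unfolding char_def by (subst integral_distr) (auto simp: mult.assoc)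
      have K0: "emeasure ?K {x} = 0" for x
      proof -
        have "(\<lambda>x. l * x) -` {x} \<inter> space fejer_distribution = {x / l}"
          using l by (auto simp: field_simps)
        then show ?thesis by (simp add: emeasure_distr fejer_distribution_singleton)
      qed
      have "\<bar>cdf F x - cdf std_normal_distribution x\<bar> \<le> 2 * (l * J / pi) + 4 * (l * h)"
      proof (rule smoothing_inequality[OF F K])
        have "(\<lambda>x. l * x) -` {y. l * h < \<bar>y\<bar>} \<inter> space fejer_distribution = {y. h < \<bar>y\<bar>}"
          using l by (auto simp: abs_mult)
        then show "measure ?K {y. l * h < \<bar>y\<bar>} \<le> 1 / 4"
          using h by (simp add: measure_distr)
        show "0 \<le> l * h" using l h by simp
        fix x
        show "\<bar>cdf (F \<star> ?K) x - cdf (std_normal_distribution \<star> ?K) x\<bar> \<le> l * J / pi"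
          unfolding J_def integral_mult_right_zero[symmetric]
        proof (rule cdf_diff_le_char_diff)
          show "real_distribution (F \<star> ?K)" "real_distribution (std_normal_distribution \<star> ?K)"
            by (intro real_distribution_convolution F K real_dist_normal_dist)+
          show "measure (F \<star> ?K) {x} = 0" "measure (std_normal_distribution \<star> ?K) {x} = 0" for x
            by (intro convolution_singleton F K K0 real_dist_normal_dist)+
          show "integrable lborel (\<lambda>t. l * (t\<^sup>2 * exp (- t\<^sup>2 / 6)))"
            using integrable_gaussian_sq by (rule integrable_mult_right)
          fix t :: real
          have eq: "char (F \<star> ?K) t - char (std_normal_distribution \<star> ?K) t =
              (char \<nu> (t / sqrt (real n)) ^ n - exp (- t\<^sup>2 / 2)) * char fejer_distribution (t * l)"
            by (simp add: char_convolution[OF F K] char_convolution[OF real_dist_normal_dist K]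
                char_F char_K char_std_normal_distribution left_diff_distrib)
          show "cmod (char (F \<star> ?K) t - char (std_normal_distribution \<star> ?K) t)
              \<le> \<bar>t\<bar> * (l * (t\<^sup>2 * exp (- t\<^sup>2 / 6)))"
          proof (cases "1 \<le> \<bar>t * l\<bar>")
            case True
            then show ?thesis using l by (simp add: eq char_fejer_eq_0)
          next
            case False
            then have t: "\<bar>t\<bar> \<le> sqrt (real n) / \<rho>"
              using l n \<rho>_ge_1 by (simp add: abs_mult l_def field_simps)
            have "cmod (char (F \<star> ?K) t - char (std_normal_distribution \<star> ?K) t)
                \<le> \<bar>t\<bar> ^ 3 * \<rho> / sqrt (real n) * exp (- t\<^sup>2 / 6) * 1"
              unfolding eq norm_mult 
              by (intro mult_mono char_sum_near_gaussian n2 t K.cmod_char_le_1) (use \<rho>_ge_1 in auto)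
            also have "\<dots> = \<bar>t\<bar> * (l * (t\<^sup>2 * exp (- t\<^sup>2 / 6)))"
              by (simp add: l_def power3_eq_cube power2_eq_square)
            finally show ?thesis .
          qed
        qed
      qed
      also have "\<dots> \<le> C * l"
        using l by (simp add: C_def algebra_simps)
      finally show ?thesis .
    qed
    then show "\<bar>cdf F x - cdf std_normal_distribution x\<bar> \<le> C * (\<integral>x. \<bar>x\<bar> ^ 3 \<partial>\<nu>) / sqrt (real n)"
      by (simp add: l_def \<rho>_def)
  qed
qed

text \<open>
  A chosen constant is used instead of an existential statement because it must be the same for
  all laws and all underlying probability spaces.
\<close>

definition berry_esseen_constant :: real where
  "berry_esseen_constant = (SOME C. 0 < C \<and>
     (\<forall>\<nu> F n x. standardized_law_third_moment \<nu> \<longrightarrow> real_distribution F \<longrightarrow> 1 \<le> n \<longrightarrow>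
        (\<forall>t. char F t = char \<nu> (t / sqrt (real n)) ^ n) \<longrightarrow>
        \<bar>cdf F x - cdf std_normal_distribution x\<bar> \<le> C * (\<integral>x. \<bar>x\<bar> ^ 3 \<partial>\<nu>) / sqrt (real n)))"

lemma
  shows berry_esseen_constant_pos: "0 < berry_esseen_constant"
    and berry_esseen_char: "\<lbrakk>standardized_law_third_moment \<nu>; real_distribution F; 1 \<le> n;
       \<And>t. char F t = char \<nu> (t / sqrt (real n)) ^ n\<rbrakk> \<Longrightarrow>
       \<bar>cdf F x - cdf std_normal_distribution x\<bar>
         \<le> berry_esseen_constant * (\<integral>x. \<bar>x\<bar> ^ 3 \<partial>\<nu>) / sqrt (real n)"
proof -
  obtain C where "0 < C"
    "\<And>\<nu> F n x. \<lbrakk>standardized_law_third_moment \<nu>; real_distribution F; n \<ge> 1;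
       \<And>t. char F t = char \<nu> (t / sqrt (real n)) ^ n\<rbrakk> \<Longrightarrow>
       \<bar>cdf F x - cdf std_normal_distribution x\<bar> \<le> C * (\<integral>x. \<bar>x\<bar> ^ 3 \<partial>\<nu>) / sqrt (real n)"
    by (rule exists_berry_esseen_constant) blast
  then have "\<exists>C>0. \<forall>\<nu> F n x. standardized_law_third_moment \<nu> \<longrightarrow> real_distribution F \<longrightarrow> 1 \<le> n \<longrightarrow>
        (\<forall>t. char F t = char \<nu> (t / sqrt (real n)) ^ n) \<longrightarrow>
        \<bar>cdf F x - cdf std_normal_distribution x\<bar> \<le> C * (\<integral>x. \<bar>x\<bar> ^ 3 \<partial>\<nu>) / sqrt (real n)"
    by blast
  from someI_ex[OF this] show "0 < berry_esseen_constant"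
    and "\<lbrakk>standardized_law_third_moment \<nu>; real_distribution F; 1 \<le> n;
       \<And>t. char F t = char \<nu> (t / sqrt (real n)) ^ n\<rbrakk> \<Longrightarrow>
       \<bar>cdf F x - cdf std_normal_distribution x\<bar>
         \<le> berry_esseen_constant * (\<integral>x. \<bar>x\<bar> ^ 3 \<partial>\<nu>) / sqrt (real n)"
    unfolding berry_esseen_constant_def by blast+
qed

text \<open>
  A uniform bound passes to left limits since \<open>\<Phi>\<close> is continuous. It is needed for the event that
  a sum is strictly negative.
\<close>

lemma cdf_diff_bound_lessThan:
  assumes F: "real_distribution F"
    and B: "\<And>x. \<bar>cdf F x - cdf std_normal_distribution x\<bar> \<le> B"
  shows "\<bar>measure F {..<x} - cdf std_normal_distribution x\<bar> \<le> B"
proof -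
  interpret F: real_distribution F by (rule F)
  interpret N: real_distribution std_normal_distribution by (rule real_dist_normal_dist)
  let ?\<Phi> = "cdf std_normal_distribution"
  have "1-lipschitz_on UNIV ?\<Phi>"
    using cdf_std_normal_lipschitz by (intro lipschitz_onI) (auto simp: dist_real_def)
  then have "isCont ?\<Phi> x"
    using lipschitz_on_continuous_on continuous_on_eq_continuous_at[OF open_UNIV] by blast
  then have "(?\<Phi> \<longlongrightarrow> ?\<Phi> x) (at_left x)"
    by (auto simp: isCont_def intro: tendsto_within_subset)
  then have "((\<lambda>y. \<bar>cdf F y - ?\<Phi> y\<bar>) \<longlongrightarrow> \<bar>measure F {..<x} - ?\<Phi> x\<bar>) (at_left x)"
    by (intro tendsto_intros F.cdf_at_left)
  then show ?thesis
    by (rule tendsto_upperbound) (use B in auto)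
qed

theorem berry_esseen_iid:
  fixes M :: "'a measure" and Z :: "nat \<Rightarrow> 'a \<Rightarrow> real" and \<nu> :: "real measure"
    and n :: nat and m s x :: real
  assumes M: "prob_space M" and indep: "prob_space.indep_vars M (\<lambda>_. borel) Z {1..n}"
    and n: "1 \<le> n" and \<nu>: "\<And>i. i \<in> {1..n} \<Longrightarrow> distr M borel (Z i) = \<nu>"
    and int: "integrable \<nu> (\<lambda>z. \<bar>z - m\<bar> ^ 3)" and m: "(\<integral>z. z \<partial>\<nu>) = m"
    and s2: "(\<integral>z. (z - m)\<^sup>2 \<partial>\<nu>) = s\<^sup>2" and s: "0 < s"
  shows "\<bar>measure M {\<omega> \<in> space M. (\<Sum>i=1..n. Z i \<omega>) \<le> x}
         - cdf std_normal_distribution ((x - real n * m) / (s * sqrt (real n)))\<bar>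
         \<le> berry_esseen_constant * (\<integral>z. \<bar>z - m\<bar> ^ 3 \<partial>\<nu>) / (s ^ 3 * sqrt (real n))"
       "\<bar>measure M {\<omega> \<in> space M. (\<Sum>i=1..n. Z i \<omega>) < x}
         - cdf std_normal_distribution ((x - real n * m) / (s * sqrt (real n)))\<bar>
         \<le> berry_esseen_constant * (\<integral>z. \<bar>z - m\<bar> ^ 3 \<partial>\<nu>) / (s ^ 3 * sqrt (real n))"
proof -
  interpret prob_space M by (rule M)
  have Z [measurable]: "Z i \<in> borel_measurable M" if "i \<in> {1..n}" for i
    using indep that unfolding indep_vars_def2 by auto
  define r where "r = sqrt (real n)"
  have r: "0 < r" using n by (simp add: r_def)
  have r2: "r * r = real n" by (simp add: r_def)
  interpret \<nu>: real_distribution \<nu>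
    using \<nu>[of 1] Z[of 1] n by (auto simp flip: \<nu>[of 1])
  have le3: "(z - m)\<^sup>2 \<le> 1 + \<bar>z - m\<bar> ^ 3" for z
  proof (cases "\<bar>z - m\<bar> \<le> 1")
    case True
    then have "(z - m)\<^sup>2 \<le> 1" by (simp add: abs_square_le_1)
    then show ?thesis by (simp add: add_increasing2)
  next
    case False
    then have "\<bar>z - m\<bar> ^ 2 \<le> \<bar>z - m\<bar> ^ 3" by (intro power_increasing) auto
    then show ?thesis by simp
  qed
  have int2: "integrable \<nu> (\<lambda>z. (z - m)\<^sup>2)"
    by (rule Bochner_Integration.integrable_bound[of _ "\<lambda>z. 1 + \<bar>z - m\<bar> ^ 3"])
      (use int le3 in \<open>auto intro!: AE_I2 simp: add_nonneg_nonneg abs_of_nonneg\<close>)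
  have int1: "integrable \<nu> (\<lambda>z. z - m)"
    by (rule \<nu>.square_integrable_imp_integrable[OF _ int2]) simp
  have "integrable \<nu> (\<lambda>z. (z - m) + m)" using int1 by (intro Bochner_Integration.integrable_add) auto
  then have int0: "integrable \<nu> (\<lambda>z. z)" by simp
  let ?\<nu>' = "distr \<nu> borel (\<lambda>z. (z - m) / s)"
  have std: "standardized_law_third_moment ?\<nu>'"
  proof (intro standardized_law_third_moment.intro standardized_law.intro
      standardized_law_axioms.intro standardized_law_third_moment_axioms.intro)
    show "real_distribution ?\<nu>'" by simp
    show "integrable ?\<nu>' (\<lambda>x. \<bar>x\<bar> ^ 3)"
      using int by (subst integrable_distr_eq) (auto simp: power_divide)
    show "integrable ?\<nu>' (\<lambda>x. x\<^sup>2)"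
      using int2 by (subst integrable_distr_eq) (auto simp: power_divide)
    show "(\<integral>x. x \<partial>?\<nu>') = 0"
    proof (subst integral_distr)
      have "(\<integral>z. z - m \<partial>\<nu>) = 0"
        using int0 m \<nu>.prob_space by (simp add: Bochner_Integration.integral_diff)
      then show "(\<integral>z. (z - m) / s \<partial>\<nu>) = 0" by simp
    qed auto
    show "(\<integral>x. x\<^sup>2 \<partial>?\<nu>') = 1"
    proof (subst integral_distr)
      show "(\<integral>z. ((z - m) / s)\<^sup>2 \<partial>\<nu>) = 1"
        using s by (simp add: power_divide s2)
    qed auto
  qed
  let ?F = "distr M borel (\<lambda>\<omega>. \<Sum>i=1..n. (Z i \<omega> - m) / (s * r))"
  have F: "real_distribution ?F" by (intro real_distribution_distr) measurable
  have "char ?F t = char ?\<nu>' (t / sqrt (real n)) ^ n" for t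
  proof -
    have "char ?F t = (\<Prod>i=1..n. char (distr M borel (\<lambda>\<omega>. (Z i \<omega> - m) / (s * r))) t)"
      by (rule char_distr_sum, rule indep_vars_compose2[where X=Z, OF indep]) auto
    also have "\<dots> = (\<Prod>i=1..n. char ?\<nu>' (t / r))"
    proof (rule prod.cong[OF refl])
      fix i assume i: "i \<in> {1..n}"
      have "distr M borel (\<lambda>\<omega>. (Z i \<omega> - m) / (s * r)) = distr \<nu> borel (\<lambda>z. (z - m) / (s * r))"
        using Z[OF i] by (simp add: distr_distr comp_def flip: \<nu>[OF i])
      then show "char (distr M borel (\<lambda>\<omega>. (Z i \<omega> - m) / (s * r))) t = char ?\<nu>' (t / r)"
        by (simp add: char_def integral_distr)
    qed
    finally show ?thesis by (simp add: r_def)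
  qed
  from berry_esseen_char[OF std F n this]
  have bd: "\<bar>cdf ?F y - cdf std_normal_distribution y\<bar>
      \<le> berry_esseen_constant * (\<integral>z. \<bar>z - m\<bar> ^ 3 \<partial>\<nu>) / (s ^ 3 * r)" for y
    using s by (simp add: integral_distr power_divide r_def)
  have sum_eq: "(\<Sum>i=1..n. (Z i \<omega> - m) / (s * r)) = ((\<Sum>i=1..n. Z i \<omega>) - real n * m) / (s * r)" for \<omega>
    by (simp add: sum_divide_distrib[symmetric] sum_subtractf)
  let ?y = "(x - real n * m) / (s * r)"
  have iff: "(\<Sum>i=1..n. (Z i \<omega> - m) / (s * r)) \<le> ?y \<longleftrightarrow> (\<Sum>i=1..n. Z i \<omega>) \<le> x"
    "(\<Sum>i=1..n. (Z i \<omega> - m) / (s * r)) < ?y \<longleftrightarrow> (\<Sum>i=1..n. Z i \<omega>) < x" for \<omega>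
    unfolding sum_eq using mult_pos_pos[OF s r] by (auto simp: divide_le_cancel divide_less_cancel)
  have "{\<omega> \<in> space M. (\<Sum>i=1..n. Z i \<omega>) \<le> x} = (\<lambda>\<omega>. \<Sum>i=1..n. (Z i \<omega> - m) / (s * r)) -` {..?y} \<inter> space M"
    using iff(1) by blast
  then have "measure M {\<omega> \<in> space M. (\<Sum>i=1..n. Z i \<omega>) \<le> x} = cdf ?F ?y"
    unfolding cdf_def by (subst measure_distr) auto
  moreover have "{\<omega> \<in> space M. (\<Sum>i=1..n. Z i \<omega>) < x}
      = (\<lambda>\<omega>. \<Sum>i=1..n. (Z i \<omega> - m) / (s * r)) -` {..<?y} \<inter> space M"
    using iff(2) by blast
  then have "measure M {\<omega> \<in> space M. (\<Sum>i=1..n. Z i \<omega>) < x} = measure ?F {..<?y}"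
    by (subst measure_distr) auto
  ultimately show "\<bar>measure M {\<omega> \<in> space M. (\<Sum>i=1..n. Z i \<omega>) \<le> x}
       - cdf std_normal_distribution ((x - real n * m) / (s * sqrt (real n)))\<bar>
       \<le> berry_esseen_constant * (\<integral>z. \<bar>z - m\<bar> ^ 3 \<partial>\<nu>) / (s ^ 3 * sqrt (real n))"
     "\<bar>measure M {\<omega> \<in> space M. (\<Sum>i=1..n. Z i \<omega>) < x}
       - cdf std_normal_distribution ((x - real n * m) / (s * sqrt (real n)))\<bar>
       \<le> berry_esseen_constant * (\<integral>z. \<bar>z - m\<bar> ^ 3 \<partial>\<nu>) / (s ^ 3 * sqrt (real n))"
    using bd cdf_diff_bound_lessThan[OF F bd] by (simp_all add: r_def)
qed

section \<open>Catoni influence functions\<close>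

text \<open>
  This symmetry reduces two-sided bounds on influence functions to non-negative arguments.
\<close>

lemma catoni_influence_uminus:
  assumes "catoni_influence \<phi>" shows "catoni_influence (\<lambda>x. - \<phi> (- x))"
  unfolding catoni_influence_def
proof (intro conjI allI)
  have c: "continuous_on UNIV \<phi>" and m: "mono \<phi>"
    and b: "\<And>x. - ln (1 - x + x\<^sup>2 / 2) \<le> \<phi> x \<and> \<phi> x \<le> ln (1 + x + x\<^sup>2 / 2)"
    using assms by (auto simp: catoni_influence_def)
  show "continuous_on UNIV (\<lambda>x. - \<phi> (- x))"
    by (intro continuous_intros continuous_on_compose2[OF c]) auto
  show "mono (\<lambda>x. - \<phi> (- x))" using m by (auto simp: mono_def)
  show "- ln (1 - x + x\<^sup>2 / 2) \<le> - \<phi> (- x)" "- \<phi> (- x) \<le> ln (1 + x + x\<^sup>2 / 2)" for x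
    using b[of "- x"] by auto
qed

context
  fixes \<phi> :: "real \<Rightarrow> real" assumes \<phi>: "catoni_influence \<phi>"
begin

lemma catoni_influence_mono: "x \<le> y \<Longrightarrow> \<phi> x \<le> \<phi> y"
  using \<phi> by (auto simp: catoni_influence_def mono_def)

lemma measurable_catoni_influence: "\<phi> \<in> borel_measurable borel"
  using \<phi> by (auto simp: catoni_influence_def intro: borel_measurable_continuous_onI)

lemma catoni_influence_0: "\<phi> 0 = 0"
proof -
  have "- ln (1 - 0 + 0\<^sup>2 / 2) \<le> \<phi> 0 \<and> \<phi> 0 \<le> ln (1 + 0 + 0\<^sup>2 / 2)"
    using \<phi> unfolding catoni_influence_def by blast
  then show ?thesis by simp
qed

text \<open>
  Both logarithmic bounds agree with the identity to second order, as \<open>1 + x + x\<^sup>2 / 2\<close> is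
  \<open>exp x\<close> up to a cubic term. For \<open>x \<ge> 1\<close> the lower bounds are trivial because \<open>\<phi> x \<ge> 0\<close>.
\<close>

lemma catoni_influence_bounds_nonneg:
  assumes x: "0 \<le> x"
  shows "0 \<le> \<phi> x" "\<phi> x \<le> x" "x - \<phi> x \<le> x\<^sup>2" "x - \<phi> x \<le> x ^ 3"
proof -
  show nonneg: "0 \<le> \<phi> x" using catoni_influence_mono[OF x] catoni_influence_0 by simp
  have "\<phi> x \<le> ln (1 + x + x\<^sup>2 / 2)" using \<phi> by (auto simp: catoni_influence_def)
  also have "\<dots> \<le> ln (exp x)"
    using exp_lower_Taylor_quadratic[OF x] x by (subst ln_le_cancel_iff) (auto intro: add_pos_nonneg)
  finally show "\<phi> x \<le> x" by simp
  have "x - \<phi> x \<le> x\<^sup>2 \<and> x - \<phi> x \<le> x ^ 3"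
  proof (cases "x \<le> 1")
    case False
    then have "x ^ 1 \<le> x ^ 2" "x ^ 1 \<le> x ^ 3" by (intro power_increasing; simp)+
    then show ?thesis using nonneg by auto
  next
    case True
    have pos: "0 < 1 - x + x\<^sup>2 / 2"
    proof -
      have "0 < ((1 - x)\<^sup>2 + 1) / 2" by (simp add: add_nonneg_pos)
      also have "\<dots> = 1 - x + x\<^sup>2 / 2" by (simp add: power2_eq_square field_simps)
      finally show ?thesis .
    qed
    have "exp x \<le> exp 1" using True by simp
    also have "\<dots> \<le> 3" using exp_le by simp
    finally have e: "exp x * x ^ 3 / 6 \<le> x ^ 3 / 2"
      using mult_right_mono[of "exp x" 3 "x ^ 3"] x by simp
    have "1 - x + x\<^sup>2 / 2 \<le> exp (- x) + x ^ 3 / 6"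
      using exp_minus_ge_cubic[OF x] by simp
    also have "\<dots> = exp (- x) * (1 + exp x * x ^ 3 / 6)"
      by (simp add: exp_minus field_simps)
    also have "\<dots> \<le> exp (- x) * exp (x ^ 3 / 2)"
      using order_trans[OF add_left_mono[OF e, of 1] exp_ge_add_one_self[of "x ^ 3 / 2"]]
      by (intro mult_left_mono) auto
    finally have "1 - x + x\<^sup>2 / 2 \<le> exp (- x + x ^ 3 / 2)" by (simp only: exp_add)
    then have "ln (1 - x + x\<^sup>2 / 2) \<le> ln (exp (- x + x ^ 3 / 2))"
      using pos by (subst ln_le_cancel_iff) auto
    moreover have "- ln (1 - x + x\<^sup>2 / 2) \<le> \<phi> x" using \<phi> by (auto simp: catoni_influence_def)
    ultimately have *: "x - \<phi> x \<le> x ^ 3 / 2" by simp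
    moreover have "x ^ 3 \<le> x ^ 2" using x True by (intro power_decreasing) auto
    moreover have "0 \<le> x ^ 3" using x by simp
    ultimately show ?thesis by linarith
  qed
  then show "x - \<phi> x \<le> x\<^sup>2" "x - \<phi> x \<le> x ^ 3" by auto
qed

end

lemma catoni_influence_bounds:
  assumes "catoni_influence \<phi>"
  shows "\<bar>\<phi> x\<bar> \<le> \<bar>x\<bar>" "\<bar>\<phi> x - x\<bar> \<le> x\<^sup>2" "\<bar>\<phi> x - x\<bar> \<le> \<bar>x\<bar> ^ 3"
proof -
  have "\<bar>\<phi> x\<bar> \<le> \<bar>x\<bar> \<and> \<bar>\<phi> x - x\<bar> \<le> x\<^sup>2 \<and> \<bar>\<phi> x - x\<bar> \<le> \<bar>x\<bar> ^ 3"
  proof (cases "0 \<le> x")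
    case True
    then show ?thesis using catoni_influence_bounds_nonneg[OF assms True] by auto
  next
    case False
    then have "0 \<le> - x" by simp
    from catoni_influence_bounds_nonneg[OF catoni_influence_uminus[OF assms] this] False
    show ?thesis by (auto simp: abs_if)
  qed
  then show "\<bar>\<phi> x\<bar> \<le> \<bar>x\<bar>" "\<bar>\<phi> x - x\<bar> \<le> x\<^sup>2" "\<bar>\<phi> x - x\<bar> \<le> \<bar>x\<bar> ^ 3" by auto
qed

section \<open>Truncated moments of a standardised law\<close>

context standardized_law
begin

text \<open>
  This moment measures how far the law is from being degenerate. It is the source of the
  dependence of the constant on the law, through \<open>truncated_moment_le\<close> below.
\<close>

definition truncated_moment :: real where
  "truncated_moment = (\<integral>x. min (x\<^sup>2) (\<bar>x\<bar> ^ 3) \<partial>\<nu>)"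

lemma prob_UNIV: "measure \<nu> UNIV = 1"
  using prob_space by simp

lemma integrable_min_moment: "integrable \<nu> (\<lambda>x. min (x\<^sup>2) (\<bar>x\<bar> ^ 3))"
  by (rule Bochner_Integration.integrable_bound[OF integrable_sq]) auto

lemma truncated_moment_pos: "0 < truncated_moment"
proof (rule ccontr)
  assume "\<not> 0 < truncated_moment"
  moreover have "0 \<le> truncated_moment"
    unfolding truncated_moment_def by (rule integral_nonneg_AE) simp
  ultimately have "(\<integral>x. min (x\<^sup>2) (\<bar>x\<bar> ^ 3) \<partial>\<nu>) = 0" unfolding truncated_moment_def by linarith
  then have "AE x in \<nu>. min (x\<^sup>2) (\<bar>x\<bar> ^ 3) = 0"
    by (subst (asm) integral_nonneg_eq_0_iff_AE[OF integrable_min_moment]) auto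
  then have "AE x in \<nu>. x\<^sup>2 = 0" by eventually_elim (auto simp: min_def split: if_splits)
  then have "(\<integral>x. x\<^sup>2 \<partial>\<nu>) = 0"
    by (subst integral_nonneg_eq_0_iff_AE[OF integrable_sq]) auto
  then show False using variance_1 by simp
qed

abbreviation cube_constant :: real where "cube_constant \<equiv> 4 * (1 + 1 / truncated_moment)"

lemma cube_constant_pos: "0 < cube_constant"
  using truncated_moment_pos by (simp add: add_pos_pos)

text \<open>
  In this quantity the error bound is expressed; \<open>beta_standardize\<close> below relates it to the
  original law.
\<close>

definition beta :: "nat \<Rightarrow> real" where "beta n = beta2 \<nu> 0 1 n + beta3 \<nu> 0 1 n"

lemma integrable_abs3_trunc: "integrable \<nu> (\<lambda>x. \<bar>x\<bar> ^ 3 * indicator {x. \<bar>x\<bar> \<le> c} x)"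
proof (rule integrable_const_bound[where B = "\<bar>c\<bar> ^ 3"])
  show "AE x in \<nu>. norm (\<bar>x\<bar> ^ 3 * indicator {x. \<bar>x\<bar> \<le> c} x) \<le> \<bar>c\<bar> ^ 3"
    by (auto split: split_indicator intro!: power_mono AE_I2)
qed simp

lemma integrable_sq_indicator: "A \<in> sets borel \<Longrightarrow> integrable \<nu> (\<lambda>x. x\<^sup>2 * indicator A x)"
  using integrable_mult_indicator[OF _ integrable_sq, of A] by (simp add: mult.commute)

lemma beta2_nonneg: "0 \<le> beta2 \<nu> 0 1 n" and beta3_nonneg: "0 \<le> beta3 \<nu> 0 1 n"
  unfolding beta2_def beta3_def by (auto intro!: mult_nonneg_nonneg integral_nonneg_AE)

text \<open>
  The last inequality says that \<open>beta n\<close> is at least of order \<open>1 / sqrt n\<close>, so that errors of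
  that order are admissible throughout. Pointwise, \<open>min (x\<^sup>2) (\<bar>x\<bar>\<^sup>3)\<close> is at most \<open>sqrt n * x\<^sup>2\<close>
  where \<open>\<bar>x\<bar> \<ge> sqrt n\<close> and at most \<open>\<bar>x\<bar>\<^sup>3\<close> elsewhere.
\<close>

lemma
  assumes n: "1 \<le> n"
  shows abs3_trunc_le: "(\<integral>x. \<bar>x\<bar> ^ 3 * indicator {x. \<bar>x\<bar> \<le> sqrt (real n)} x \<partial>\<nu>) \<le> sqrt (real n) * beta n"
    and sq_tail_le: "(\<integral>x. x\<^sup>2 * indicator {x. sqrt (real n) < \<bar>x\<bar>} x \<partial>\<nu>) \<le> beta n"
    and truncated_moment_le: "truncated_moment \<le> sqrt (real n) * beta n"
proof -
  let ?r = "sqrt (real n)"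
  have r: "1 \<le> ?r" using n by simp
  let ?b2 = "\<integral>x. x\<^sup>2 * indicator {x. ?r \<le> \<bar>x\<bar>} x \<partial>\<nu>"
  let ?b3 = "\<integral>x. \<bar>x\<bar> ^ 3 * indicator {x. \<bar>x\<bar> \<le> ?r} x \<partial>\<nu>"
  have b2: "beta2 \<nu> 0 1 n = ?b2" by (simp add: beta2_def)
  have b3: "?r * beta3 \<nu> 0 1 n = ?b3" using r by (simp add: beta3_def)
  have eq: "?r * beta n = ?r * ?b2 + ?b3" by (simp add: beta_def distrib_left b2 b3)
  show "?b3 \<le> ?r * beta n" using beta2_nonneg[of n] r by (simp add: eq flip: b2)
  have "(\<integral>x. x\<^sup>2 * indicator {x. ?r < \<bar>x\<bar>} x \<partial>\<nu>) \<le> ?b2"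
    by (intro integral_mono integrable_sq_indicator) (auto split: split_indicator)
  then show "(\<integral>x. x\<^sup>2 * indicator {x. ?r < \<bar>x\<bar>} x \<partial>\<nu>) \<le> beta n"
    using beta3_nonneg[of n] by (simp add: beta_def b2)
  have "truncated_moment \<le> (\<integral>x. ?r * (x\<^sup>2 * indicator {x. ?r \<le> \<bar>x\<bar>} x)
      + \<bar>x\<bar> ^ 3 * indicator {x. \<bar>x\<bar> \<le> ?r} x \<partial>\<nu>)"
    unfolding truncated_moment_def
  proof (intro integral_mono integrable_min_moment Bochner_Integration.integrable_add
      integrable_mult_right integrable_sq_indicator integrable_abs3_trunc)
    fix x :: real
    have "x\<^sup>2 \<le> ?r * x\<^sup>2" using mult_right_mono[OF r, of "x\<^sup>2"] by simp
    then show "min (x\<^sup>2) (\<bar>x\<bar> ^ 3) \<le> ?r * (x\<^sup>2 * indicator {x. ?r \<le> \<bar>x\<bar>} x)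
        + \<bar>x\<bar> ^ 3 * indicator {x. \<bar>x\<bar> \<le> ?r} x"
      by (auto split: split_indicator simp: min_def add_increasing2)
  qed simp
  also have "\<dots> = ?r * ?b2 + ?b3"
    by (subst Bochner_Integration.integral_add) (auto intro!: integrable_mult_right integrable_sq_indicator integrable_abs3_trunc)
  finally show "truncated_moment \<le> ?r * beta n" by (simp add: eq)
qed

lemma beta_pos: assumes "1 \<le> n" shows "0 < beta n"
proof -
  have "0 < sqrt (real n) * beta n"
    using truncated_moment_pos truncated_moment_le[OF assms] by linarith
  then show ?thesis using assms by (simp add: zero_less_mult_iff)
qed

end

section \<open>Moments of the truncated summands\<close>

text \<open>
  One sample size \<open>n\<close> and one point \<open>t\<close> at which the distribution function of the estimator is
  evaluated. The restriction \<open>\<bar>t\<bar> \<le> 1\<close> keeps \<open>\<bar>x - t\<bar>\<close> comparable to \<open>\<bar>x\<bar>\<close> on the tail and the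
  moments of \<open>x - t\<close> bounded.
\<close>

locale catoni_step = standardized_law +
  fixes \<phi> :: "real \<Rightarrow> real" and a A t :: real and n :: nat
  assumes \<phi>: "catoni_influence \<phi>" and n: "1 \<le> n" and a: "0 < a" and aA: "sqrt (real n) * a \<le> A"
    and t: "\<bar>t\<bar> \<le> 1"
begin

abbreviation r :: real where "r \<equiv> sqrt (real n)"
abbreviation b :: real where "b \<equiv> beta n"
abbreviation I :: "real set" where "I \<equiv> {x. \<bar>x\<bar> \<le> r}"
abbreviation J :: "real set" where "J \<equiv> {x. r < \<bar>x\<bar>}"

text \<open>
  Dividing by \<open>a\<close> makes the summand a perturbation of \<open>x - t\<close>, however small \<open>a\<close> is; \<open>w\<close> is its
  truncation.
\<close>

definition W :: "real \<Rightarrow> real" where "W x = \<phi> (a * (x - t)) / a"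
definition w :: "real \<Rightarrow> real" where "w x = W x * indicator I x"

lemma r: "1 \<le> r" using n by simp
lemma b: "0 < b" using n by (rule beta_pos)
lemma A: "0 < A" using mult_pos_pos[of r a] r a aA by linarith
lemma a_le: "a \<le> A / r" using aA r by (simp add: field_simps)

lemma one_le: "1 \<le> r * b / truncated_moment"
  using truncated_moment_le[OF n] truncated_moment_pos by (simp add: field_simps)

lemma W_bounds: "\<bar>W x\<bar> \<le> \<bar>x - t\<bar>" "\<bar>W x - (x - t)\<bar> \<le> a * (x - t)\<^sup>2"
  "\<bar>W x - (x - t)\<bar> \<le> a\<^sup>2 * \<bar>x - t\<bar> ^ 3"
proof -
  let ?y = "a * (x - t)"
  have eq: "W x - (x - t) = (\<phi> ?y - ?y) / a" using a by (simp add: W_def field_simps)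
  show "\<bar>W x\<bar> \<le> \<bar>x - t\<bar>"
    using catoni_influence_bounds(1)[OF \<phi>, of ?y] a by (simp add: W_def abs_mult divide_le_eq mult.commute)
  show "\<bar>W x - (x - t)\<bar> \<le> a * (x - t)\<^sup>2"
    using catoni_influence_bounds(2)[OF \<phi>, of ?y] a
    by (simp add: eq abs_mult power_mult_distrib divide_le_eq power2_eq_square mult_ac)
  show "\<bar>W x - (x - t)\<bar> \<le> a\<^sup>2 * \<bar>x - t\<bar> ^ 3"
    using catoni_influence_bounds(3)[OF \<phi>, of ?y] a
    by (simp add: eq abs_mult power_mult_distrib divide_le_eq power2_eq_square power3_eq_cube mult_ac)
qed

lemma measurable_W [measurable]: "W \<in> borel_measurable borel"
  unfolding W_def using measurable_catoni_influence[OF \<phi>] by measurable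

lemma measurable_w [measurable]: "w \<in> borel_measurable borel"
  unfolding w_def by measurable

lemma w_abs: "\<bar>w x\<bar> \<le> \<bar>x - t\<bar> * indicator I x"
  using W_bounds(1)[of x] by (auto simp: w_def split: split_indicator)

lemma w_bounded: "\<bar>w x\<bar> \<le> r + 1"
  using w_abs[of x] t by (auto split: split_indicator_asm)

lemma integrable_shift: "integrable \<nu> (\<lambda>x. x - t)"
  using integrable_id by simp

lemma integrable_shift_sq: "integrable \<nu> (\<lambda>x. (x - t)\<^sup>2)"
  using integrable_id integrable_sq by (simp add: power2_diff)

lemma integrable_W: "integrable \<nu> W"
  by (rule Bochner_Integration.integrable_bound[OF integrable_shift]) (auto simp: W_bounds(1))

lemma integrable_w_power: "integrable \<nu> (\<lambda>x. \<bar>w x - c\<bar> ^ k)" "integrable \<nu> (\<lambda>x. (w x - c) ^ k)"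
proof -
  have "\<bar>w x - c\<bar> ^ k \<le> (r + 1 + \<bar>c\<bar>) ^ k" for x
    using w_bounded[of x] by (intro power_mono) auto
  then show "integrable \<nu> (\<lambda>x. \<bar>w x - c\<bar> ^ k)" "integrable \<nu> (\<lambda>x. (w x - c) ^ k)"
    by (auto intro!: integrable_const_bound[where B = "(r + 1 + \<bar>c\<bar>) ^ k"] simp: power_abs)
qed

lemma integrable_w: "integrable \<nu> w" "integrable \<nu> (\<lambda>x. (w x)\<^sup>2)" "integrable \<nu> (\<lambda>x. \<bar>w x\<bar> ^ 3)"
  using integrable_w_power(2)[of 0 1] integrable_w_power(2)[of 0 2] integrable_w_power(1)[of 0 3] by simp_all

text \<open>
  The contribution of \<open>t\<close> to the third moment is a constant, which is absorbed by
  \<open>1 \<le> r * b / truncated_moment\<close>.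
\<close>

lemma abs3_shift_trunc:
  shows "integrable \<nu> (\<lambda>x. \<bar>x - t\<bar> ^ 3 * indicator I x)"
    and "(\<integral>x. \<bar>x - t\<bar> ^ 3 * indicator I x \<partial>\<nu>) \<le> cube_constant * (r * b)"
proof -
  have int: "integrable \<nu> (\<lambda>x. 4 * (\<bar>x\<bar> ^ 3 * indicator I x + 1))"
    by (intro integrable_mult_right Bochner_Integration.integrable_add integrable_abs3_trunc integrable_const)
  have le: "\<bar>x - t\<bar> ^ 3 * indicator I x \<le> 4 * (\<bar>x\<bar> ^ 3 * indicator I x + 1)" for x
    using abs_diff_power3_le[of x t] power_mono[OF t, of 3] by (auto split: split_indicator)
  show *: "integrable \<nu> (\<lambda>x. \<bar>x - t\<bar> ^ 3 * indicator I x)"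
    by (rule Bochner_Integration.integrable_bound[OF int]) (use le in \<open>auto simp: abs_mult\<close>)
  have "(\<integral>x. \<bar>x - t\<bar> ^ 3 * indicator I x \<partial>\<nu>) \<le> (\<integral>x. 4 * (\<bar>x\<bar> ^ 3 * indicator I x + 1) \<partial>\<nu>)"
    by (intro integral_mono * int le)
  also have "\<dots> = 4 * ((\<integral>x. \<bar>x\<bar> ^ 3 * indicator I x \<partial>\<nu>) + 1)"
    by (simp add: integrable_abs3_trunc prob_UNIV)
  also have "\<dots> \<le> 4 * (r * b + r * b / truncated_moment)"
    using abs3_trunc_le[OF n] one_le by (intro mult_left_mono add_mono) auto
  also have "\<dots> = cube_constant * (r * b)" by (simp add: algebra_simps)
  finally show "(\<integral>x. \<bar>x - t\<bar> ^ 3 * indicator I x \<partial>\<nu>) \<le> cube_constant * (r * b)" .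
qed

lemma sq_shift_tail:
  shows "integrable \<nu> (\<lambda>x. (x - t)\<^sup>2 * indicator J x)"
    and "(\<integral>x. (x - t)\<^sup>2 * indicator J x \<partial>\<nu>) \<le> 4 * b"
proof -
  have le: "(x - t)\<^sup>2 * indicator J x \<le> 4 * (x\<^sup>2 * indicator J x)" for x
  proof (cases "x \<in> J")
    case True
    then have "r < \<bar>x\<bar>" by simp
    then have "\<bar>t\<bar> \<le> \<bar>x\<bar>" using r t by linarith
    then have "t\<^sup>2 \<le> x\<^sup>2" by (simp add: abs_le_square_iff)
    then show ?thesis using abs_diff_power2_le[of x t] True by simp
  qed simp
  show *: "integrable \<nu> (\<lambda>x. (x - t)\<^sup>2 * indicator J x)"
    using integrable_mult_indicator[OF _ integrable_shift_sq, of J] by (simp add: mult.commute)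
  have "(\<integral>x. (x - t)\<^sup>2 * indicator J x \<partial>\<nu>) \<le> (\<integral>x. 4 * (x\<^sup>2 * indicator J x) \<partial>\<nu>)"
    by (intro integral_mono * integrable_mult_right integrable_sq_indicator le) simp
  also have "\<dots> \<le> 4 * b" using sq_tail_le[OF n] by simp
  finally show "(\<integral>x. (x - t)\<^sup>2 * indicator J x \<partial>\<nu>) \<le> 4 * b" .
qed

text \<open>
  On the tail \<open>\<bar>x\<bar> \<le> x\<^sup>2 / r\<close>, which gains the factor \<open>1 / r\<close> that a first moment needs.
\<close>

lemma abs_shift_tail:
  shows "integrable \<nu> (\<lambda>x. \<bar>x - t\<bar> * indicator J x)"
    and "(\<integral>x. \<bar>x - t\<bar> * indicator J x \<partial>\<nu>) \<le> 2 * b / r"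
proof -
  have le: "\<bar>x - t\<bar> * indicator J x \<le> 2 / r * (x\<^sup>2 * indicator J x)" for x
  proof (cases "x \<in> J")
    case True
    then have x: "r < \<bar>x\<bar>" by simp
    then have "\<bar>x - t\<bar> \<le> 2 * \<bar>x\<bar>" using r t by linarith
    also have "\<dots> \<le> 2 / r * x\<^sup>2"
      using mult_right_mono[of r "\<bar>x\<bar>" "\<bar>x\<bar>"] x r by (simp add: field_simps power2_eq_square)
    finally show ?thesis using True by simp
  qed simp
  show *: "integrable \<nu> (\<lambda>x. \<bar>x - t\<bar> * indicator J x)"
    using integrable_mult_indicator[OF _ integrable_abs[OF integrable_shift], of J]
        by (simp add: mult.commute)
  have "(\<integral>x. \<bar>x - t\<bar> * indicator J x \<partial>\<nu>) \<le> (\<integral>x. 2 / r * (x\<^sup>2 * indicator J x) \<partial>\<nu>)"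
    by (intro integral_mono * integrable_mult_right integrable_sq_indicator le) simp
  also have "\<dots> \<le> 2 / r * b"
    unfolding integral_mult_right_zero using sq_tail_le[OF n] r by (intro mult_left_mono) auto
  finally show "(\<integral>x. \<bar>x - t\<bar> * indicator J x \<partial>\<nu>) \<le> 2 * b / r" by simp
qed

lemma integral_shift: "(\<integral>x. x - t \<partial>\<nu>) = - t" "(\<integral>x. (x - t)\<^sup>2 \<partial>\<nu>) = 1 + t\<^sup>2"
  using integrable_id integrable_sq by (simp_all add: power2_diff mean_0 variance_1 prob_UNIV)

lemma integral_diff_le:
  assumes "integrable \<nu> f" "integrable \<nu> g" "integrable \<nu> h" "\<And>x. \<bar>f x - g x\<bar> \<le> (h x :: real)"
  shows "\<bar>(\<integral>x. f x \<partial>\<nu>) - (\<integral>x. g x \<partial>\<nu>)\<bar> \<le> (\<integral>x. h x \<partial>\<nu>)"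
proof -
  have "norm (\<integral>x. f x - g x \<partial>\<nu>) \<le> (\<integral>x. h x \<partial>\<nu>)"
    by (rule order_trans[OF integral_norm_bound integral_mono]) (use assms in auto)
  then show ?thesis using assms by simp
qed

lemma a_sq_cube_bound: "a\<^sup>2 * (cube_constant * (r * b)) \<le> A\<^sup>2 * cube_constant * (b / r)"
proof -
  have "a\<^sup>2 \<le> (A / r)\<^sup>2" using a_le a by (intro power_mono) auto
  then have "a\<^sup>2 * (cube_constant * (r * b)) \<le> (A / r)\<^sup>2 * (cube_constant * (r * b))"
    using cube_constant_pos r b by (intro mult_right_mono mult_nonneg_nonneg) auto
  also have "\<dots> = A\<^sup>2 * cube_constant * (b / r)"
  proof -
    have "(A / c)\<^sup>2 * (cube_constant * (c * b)) = A\<^sup>2 * cube_constant * (b / c)" if "0 < c" for c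
      using that by (simp add: power2_eq_square)
    then show ?thesis using r by simp
  qed
  finally show ?thesis .
qed

lemma a_cube_bound: "a * (cube_constant * (r * b)) \<le> A * cube_constant * b"
proof -
  have "a * (cube_constant * (r * b)) \<le> (A / r) * (cube_constant * (r * b))"
    using cube_constant_pos r b a_le by (intro mult_right_mono mult_nonneg_nonneg) auto
  also have "\<dots> = A * cube_constant * b" using r by simp
  finally show ?thesis .
qed

text \<open>
  The cubic bound on \<open>\<phi> x - x\<close> is used for \<open>\<bar>x\<bar> \<le> r\<close>, the quadratic one on the tail, where no
  third moment is available. This untruncated mean is the one that enters the equation for the
  centre.
\<close>

lemma mean_W: "\<bar>(\<integral>x. W x \<partial>\<nu>) + t\<bar> \<le> (A\<^sup>2 * cube_constant + 4 * A) * (b / r)"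
proof -
  let ?h = "\<lambda>x. a\<^sup>2 * (\<bar>x - t\<bar> ^ 3 * indicator I x) + a * ((x - t)\<^sup>2 * indicator J x)"
  have "\<bar>(\<integral>x. W x \<partial>\<nu>) - (\<integral>x. x - t \<partial>\<nu>)\<bar> \<le> (\<integral>x. ?h x \<partial>\<nu>)"
  proof (intro integral_diff_le integrable_W integrable_shift Bochner_Integration.integrable_add
      integrable_mult_right abs3_shift_trunc(1) sq_shift_tail(1))
    fix x show "\<bar>W x - (x - t)\<bar> \<le> ?h x"
      using W_bounds(2,3)[of x] by (auto split: split_indicator)
  qed
  also have "(\<integral>x. ?h x \<partial>\<nu>) = a\<^sup>2 * (\<integral>x. \<bar>x - t\<bar> ^ 3 * indicator I x \<partial>\<nu>)
      + a * (\<integral>x. (x - t)\<^sup>2 * indicator J x \<partial>\<nu>)"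
    by (simp add: abs3_shift_trunc(1) sq_shift_tail(1))
  also have "\<dots> \<le> a\<^sup>2 * (cube_constant * (r * b)) + A / r * (4 * b)"
    using a a_le b abs3_shift_trunc(2) sq_shift_tail(2)
    by (intro add_mono mult_left_mono mult_mono) (auto intro: integral_nonneg_AE)
  also have "\<dots> \<le> A\<^sup>2 * cube_constant * (b / r) + 4 * A * (b / r)"
    using a_sq_cube_bound by (intro add_mono) (simp_all add: mult_ac)
  finally show ?thesis by (simp add: integral_shift algebra_simps)
qed

text \<open>
  The truncated summand differs from \<open>x - t\<close> on the tail by \<open>x - t\<close> itself. This costs no more
  than \<open>b / r\<close>.
\<close>

lemma mean_w: "\<bar>(\<integral>x. w x \<partial>\<nu>) + t\<bar> \<le> (A\<^sup>2 * cube_constant + 2) * (b / r)"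
proof -
  let ?h = "\<lambda>x. a\<^sup>2 * (\<bar>x - t\<bar> ^ 3 * indicator I x) + \<bar>x - t\<bar> * indicator J x"
  have "\<bar>(\<integral>x. w x \<partial>\<nu>) - (\<integral>x. x - t \<partial>\<nu>)\<bar> \<le> (\<integral>x. ?h x \<partial>\<nu>)"
  proof (intro integral_diff_le integrable_w integrable_shift Bochner_Integration.integrable_add
      integrable_mult_right abs3_shift_trunc(1) abs_shift_tail(1))
    fix x show "\<bar>w x - (x - t)\<bar> \<le> ?h x"
      using W_bounds(3)[of x] by (auto simp: w_def split: split_indicator)
  qed
  also have "(\<integral>x. ?h x \<partial>\<nu>) = a\<^sup>2 * (\<integral>x. \<bar>x - t\<bar> ^ 3 * indicator I x \<partial>\<nu>) + (\<integral>x. \<bar>x - t\<bar> * indicator J x \<partial>\<nu>)"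
    by (simp add: abs3_shift_trunc(1) abs_shift_tail(1))
  also have "\<dots> \<le> a\<^sup>2 * (cube_constant * (r * b)) + 2 * b / r"
    using abs3_shift_trunc(2) abs_shift_tail(2) by (intro add_mono mult_left_mono) auto
  also have "\<dots> \<le> A\<^sup>2 * cube_constant * (b / r) + 2 * (b / r)"
    using a_sq_cube_bound by (intro add_mono) auto
  finally show ?thesis by (simp add: integral_shift algebra_simps)
qed

lemma second_moment_w: "\<bar>(\<integral>x. (w x)\<^sup>2 \<partial>\<nu>) - (1 + t\<^sup>2)\<bar> \<le> (2 * A * cube_constant + 4) * b"
proof -
  let ?h = "\<lambda>x. 2 * a * (\<bar>x - t\<bar> ^ 3 * indicator I x) + (x - t)\<^sup>2 * indicator J x"
  have "\<bar>(\<integral>x. (w x)\<^sup>2 \<partial>\<nu>) - (\<integral>x. (x - t)\<^sup>2 \<partial>\<nu>)\<bar> \<le> (\<integral>x. ?h x \<partial>\<nu>)"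
  proof (intro integral_diff_le integrable_w integrable_shift_sq Bochner_Integration.integrable_add
      integrable_mult_right abs3_shift_trunc(1) sq_shift_tail(1))
    fix x show "\<bar>(w x)\<^sup>2 - (x - t)\<^sup>2\<bar> \<le> ?h x"
    proof (cases "x \<in> I")
      case True
      have "\<bar>(W x)\<^sup>2 - (x - t)\<^sup>2\<bar> = \<bar>W x - (x - t)\<bar> * \<bar>W x + (x - t)\<bar>"
        by (simp add: abs_mult[symmetric] power2_eq_square algebra_simps)
      also have "\<dots> \<le> (a * (x - t)\<^sup>2) * (2 * \<bar>x - t\<bar>)"
      proof (intro mult_mono W_bounds(2))
        show "\<bar>W x + (x - t)\<bar> \<le> 2 * \<bar>x - t\<bar>" using W_bounds(1)[of x]
            by (intro order_trans[OF abs_triangle_ineq]) simp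
      qed (use a in auto)
      also have "\<dots> = 2 * a * \<bar>x - t\<bar> ^ 3"
        by (simp add: power3_eq_cube power2_eq_square abs_mult_self_eq)
      finally show ?thesis using True by (simp add: w_def)
    qed (simp add: w_def)
  qed
  also have "(\<integral>x. ?h x \<partial>\<nu>) = 2 * (a * (\<integral>x. \<bar>x - t\<bar> ^ 3 * indicator I x \<partial>\<nu>))
      + (\<integral>x. (x - t)\<^sup>2 * indicator J x \<partial>\<nu>)"
    by (simp add: abs3_shift_trunc(1) sq_shift_tail(1))
  also have "\<dots> \<le> 2 * (a * (cube_constant * (r * b))) + 4 * b"
    using abs3_shift_trunc(2) sq_shift_tail(2) a by (intro add_mono mult_left_mono) auto
  also have "\<dots> \<le> 2 * (A * cube_constant * b) + 4 * b"
    using a_cube_bound by (intro add_mono mult_left_mono) auto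
  finally show ?thesis by (simp add: integral_shift algebra_simps)
qed

lemma third_moment_w: "(\<integral>x. \<bar>w x\<bar> ^ 3 \<partial>\<nu>) \<le> cube_constant * (r * b)"
proof -
  have "(\<integral>x. \<bar>w x\<bar> ^ 3 \<partial>\<nu>) \<le> (\<integral>x. \<bar>x - t\<bar> ^ 3 * indicator I x \<partial>\<nu>)"
  proof (intro integral_mono integrable_w abs3_shift_trunc(1))
    fix x show "\<bar>w x\<bar> ^ 3 \<le> \<bar>x - t\<bar> ^ 3 * indicator I x"
      using power_mono[OF w_abs[of x], of 3]
          by (auto simp: w_def split: split_indicator_asm split_indicator)
  qed
  with abs3_shift_trunc(2) show ?thesis by linarith
qed

text \<open>
  This bounds the probability that truncation affects at least one of \<open>n\<close> observations.
\<close>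

lemma tail_prob_le: "real n * measure \<nu> J \<le> b"
proof -
  have "real n * measure \<nu> J = (\<integral>x. real n * indicator J x \<partial>\<nu>)" by simp
  also have "\<dots> \<le> (\<integral>x. x\<^sup>2 * indicator J x \<partial>\<nu>)"
  proof (intro integral_mono integrable_sq_indicator integrable_mult_right)
    fix x show "real n * indicator J x \<le> x\<^sup>2 * indicator J x"
    proof (cases "x \<in> J")
      case True
      then have "r\<^sup>2 \<le> \<bar>x\<bar>\<^sup>2" by (intro power_mono) auto
      then show ?thesis using True by simp
    qed simp
  qed (auto intro!: integrable_const_bound[where B = 1])
  also have "\<dots> \<le> b" by (rule sq_tail_le[OF n])
  finally show ?thesis .
qed

end

section \<open>Distribution of the estimator\<close>

context standardized_law
begin

definition mean_constant :: "real \<Rightarrow> real" where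
  "mean_constant A = A\<^sup>2 * (cube_constant) + 2"

definition variance_constant :: "real \<Rightarrow> real" where
  "variance_constant A = 2 * A * (cube_constant) + 4 + 3 * mean_constant A"

definition cdf_constant :: "real \<Rightarrow> real" where
  "cdf_constant A = berry_esseen_constant * 16 * (cube_constant + 8 / truncated_moment)
     + mean_constant A + 2 * variance_constant A"

end

context catoni_step
begin

definition m :: real where "m = (\<integral>x. w x \<partial>\<nu>)"

lemma mean_constant_pos: "0 < mean_constant A" using cube_constant_pos A
    by (simp add: mean_constant_def add_nonneg_pos)

lemma b_div_r_le: "b / r \<le> b"
  using r b by (simp add: divide_le_eq mult_le_cancel_left1)

lemma m_near_minus_t: "\<bar>m + t\<bar> \<le> mean_constant A * b"
  using order_trans[OF mean_w[folded mean_constant_def] mult_left_mono[OF b_div_r_le, of "mean_constant A"]] mean_constant_pos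
  unfolding m_def by simp

lemma scaled_m_near_minus_t: "\<bar>r * (m + t)\<bar> \<le> mean_constant A * b"
proof -
  have "\<bar>r * (m + t)\<bar> = r * \<bar>m + t\<bar>" using r by (simp add: abs_mult)
  also have "\<dots> \<le> r * (mean_constant A * (b / r))" using mean_w[folded mean_constant_def] r unfolding m_def by (intro mult_left_mono) auto
  also have "\<dots> = mean_constant A * b" using r by simp
  finally show ?thesis .
qed

lemma variance_w_eq: "(\<integral>x. (w x - m)\<^sup>2 \<partial>\<nu>) = (\<integral>x. (w x)\<^sup>2 \<partial>\<nu>) - m\<^sup>2"
proof -
  have "(\<integral>x. (w x - m)\<^sup>2 \<partial>\<nu>) = (\<integral>x. (w x)\<^sup>2 - 2 * m * w x + m\<^sup>2 \<partial>\<nu>)"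
    by (intro Bochner_Integration.integral_cong) (simp_all add: power2_diff)
  also have "\<dots> = (\<integral>x. (w x)\<^sup>2 \<partial>\<nu>) - 2 * m * m + m\<^sup>2"
    using integrable_w by (simp add: prob_UNIV m_def[symmetric])
  finally show ?thesis by (simp add: power2_eq_square)
qed

text \<open>
  The first moment contributes \<open>m\<^sup>2 - t\<^sup>2\<close>, which cancels the \<open>t\<^sup>2\<close> of the second moment up to
  \<open>O(b)\<close>, so the variance is close to 1 for all \<open>\<bar>t\<bar> \<le> 1\<close>.
\<close>

lemma variance_w:
  assumes small: "2 * variance_constant A * b \<le> 1"
  shows "\<bar>m\<bar> \<le> 2" "\<bar>(\<integral>x. (w x - m)\<^sup>2 \<partial>\<nu>) - 1\<bar> \<le> variance_constant A * b"
proof -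
  have "0 \<le> A * cube_constant * b" using A cube_constant_pos b by simp
  moreover have "2 * variance_constant A * b
      = 4 * (A * cube_constant * b) + 8 * b + 6 * (mean_constant A * b)"
    by (simp add: variance_constant_def algebra_simps)
  ultimately have "6 * (mean_constant A * b) \<le> 2 * variance_constant A * b" using b by linarith
  then have mt: "\<bar>m + t\<bar> \<le> 1" using small m_near_minus_t by linarith
  then show "\<bar>m\<bar> \<le> 2" using t by linarith
  have "\<bar>m\<^sup>2 - t\<^sup>2\<bar> = \<bar>m + t\<bar> * \<bar>m - t\<bar>"
    by (simp add: abs_mult[symmetric] power2_eq_square algebra_simps)
  also have "\<dots> \<le> (mean_constant A * b) * 3"
  proof (intro mult_mono m_near_minus_t)
    show "\<bar>m - t\<bar> \<le> 3" using mt t by linarith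
    show "0 \<le> mean_constant A * b" using mean_constant_pos b by simp
  qed simp
  finally show "\<bar>(\<integral>x. (w x - m)\<^sup>2 \<partial>\<nu>) - 1\<bar> \<le> variance_constant A * b"
    using second_moment_w unfolding variance_w_eq by (simp add: variance_constant_def algebra_simps)
qed

lemma third_central_moment_w:
  assumes "\<bar>m\<bar> \<le> 2"
  shows "(\<integral>x. \<bar>w x - m\<bar> ^ 3 \<partial>\<nu>) \<le> 4 * (cube_constant + 8 / truncated_moment) * (r * b)"
proof -
  have "(\<integral>x. \<bar>w x - m\<bar> ^ 3 \<partial>\<nu>) \<le> (\<integral>x. 4 * (\<bar>w x\<bar> ^ 3 + 8) \<partial>\<nu>)"
  proof (intro integral_mono integrable_w_power)
    show "integrable \<nu> (\<lambda>x. 4 * (\<bar>w x\<bar> ^ 3 + 8))" using integrable_w by simp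
    fix x show "\<bar>w x - m\<bar> ^ 3 \<le> 4 * (\<bar>w x\<bar> ^ 3 + 8)"
      using abs_diff_power3_le[of "w x" m] power_mono[OF assms, of 3] by simp
  qed
  also have "\<dots> = 4 * ((\<integral>x. \<bar>w x\<bar> ^ 3 \<partial>\<nu>) + 8)" using integrable_w by (simp add: prob_UNIV)
  also have "\<dots> \<le> 4 * (cube_constant * (r * b) + 8 * (r * b / truncated_moment))"
    using third_moment_w one_le by simp
  also have "\<dots> = 4 * (cube_constant + 8 / truncated_moment) * (r * b)" by (simp add: algebra_simps)
  finally show ?thesis .
qed

text \<open>
  Let \<open>s\<^sup>2\<close> be the variance of a summand. Berry-Esseen compares the probability with \<open>\<Phi>\<close> at
  \<open>- r * m / s\<close>, where the third moment of order \<open>r * b\<close> gives an error of order \<open>b\<close>. Replacing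
  \<open>- r * m\<close> by \<open>r * t\<close> costs \<open>O(b)\<close> by the Lipschitz bound, and removing \<open>s\<close> costs
  \<open>O(\<bar>s\<^sup>2 - 1\<bar>) = O(b)\<close> by \<open>cdf_std_normal_divide\<close>, uniformly in \<open>t\<close>.
\<close>

lemma cdf_truncated_sum:
  fixes M :: "'a measure" and Y :: "nat \<Rightarrow> 'a \<Rightarrow> real"
  assumes M: "prob_space M" and indep: "prob_space.indep_vars M (\<lambda>_. borel) Y {1..n}"
    and Y: "\<And>i. i \<in> {1..n} \<Longrightarrow> distr M borel (Y i) = \<nu>"
    and small: "2 * variance_constant A * b \<le> 1"
  shows "\<bar>measure M {\<omega> \<in> space M. (\<Sum>i=1..n. w (Y i \<omega>)) \<le> 0} - cdf std_normal_distribution (r * t)\<bar>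
      \<le> cdf_constant A * b"
    and "\<bar>measure M {\<omega> \<in> space M. (\<Sum>i=1..n. w (Y i \<omega>)) < 0} - cdf std_normal_distribution (r * t)\<bar>
        \<le> cdf_constant A * b"
proof -
  let ?\<Phi> = "cdf std_normal_distribution" and ?\<nu> = "distr \<nu> borel w"
  interpret M: prob_space M by (rule M)
  define s where "s = sqrt (\<integral>x. (w x - m)\<^sup>2 \<partial>\<nu>)"
  have s2: "s\<^sup>2 = (\<integral>x. (w x - m)\<^sup>2 \<partial>\<nu>)" unfolding s_def by (simp add: integral_nonneg_AE)
  have var: "\<bar>s\<^sup>2 - 1\<bar> \<le> variance_constant A * b" unfolding s2 by (rule variance_w(2)[OF small])
  then have s_half: "1 / 2 \<le> s\<^sup>2" using small by linarith
  have "0 \<le> s" unfolding s_def by (simp add: integral_nonneg_AE)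
  have "s \<noteq> 0" using s_half by auto
  then have s: "0 < s" using \<open>0 \<le> s\<close> by simp
  have "(1 / 2)\<^sup>2 \<le> s\<^sup>2" using s_half by (simp add: power2_eq_square)
  then have "1 / 2 \<le> s" using s by (intro power2_le_imp_le[of "1 / 2" s]) auto
  then have "1 / 2 * (1 / 2) \<le> s\<^sup>2 * s" using s_half by (intro mult_mono) auto
  then have s3: "1 / 4 \<le> s ^ 3" by (simp add: power3_eq_cube power2_eq_square)
  have Ym: "Y i \<in> borel_measurable M" if "i \<in> {1..n}" for i
    using indep that unfolding M.indep_vars_def2 by auto
  have indep': "M.indep_vars (\<lambda>_. borel) (\<lambda>i \<omega>. w (Y i \<omega>)) {1..n}"
    by (rule M.indep_vars_compose2[OF indep]) auto
  have law: "distr M borel (\<lambda>\<omega>. w (Y i \<omega>)) = ?\<nu>" if "i \<in> {1..n}" for i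
    using Ym[OF that] by (simp add: distr_distr comp_def flip: Y[OF that])
  have int: "integrable ?\<nu> (\<lambda>z. \<bar>z - m\<bar> ^ 3)"
    using integrable_w_power by (subst integrable_distr_eq) auto
  have mean: "(\<integral>z. z \<partial>?\<nu>) = m" by (subst integral_distr) (auto simp: m_def)
  have variance: "(\<integral>z. (z - m)\<^sup>2 \<partial>?\<nu>) = s\<^sup>2" unfolding s2 by (subst integral_distr) auto
  have third: "(\<integral>z. \<bar>z - m\<bar> ^ 3 \<partial>?\<nu>) = (\<integral>x. \<bar>w x - m\<bar> ^ 3 \<partial>\<nu>)" by (subst integral_distr) auto
  have rate: "berry_esseen_constant * (\<integral>x. \<bar>w x - m\<bar> ^ 3 \<partial>\<nu>) / (s ^ 3 * r)
      \<le> berry_esseen_constant * 16 * (cube_constant + 8 / truncated_moment) * b"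
  proof -
    have "(\<integral>x. \<bar>w x - m\<bar> ^ 3 \<partial>\<nu>) / (s ^ 3 * r)
        \<le> (4 * (cube_constant + 8 / truncated_moment) * (r * b)) / (1 / 4 * r)"
    proof (rule frac_le)
      show "(\<integral>x. \<bar>w x - m\<bar> ^ 3 \<partial>\<nu>) \<le> 4 * (cube_constant + 8 / truncated_moment) * (r * b)"
        by (rule third_central_moment_w[OF variance_w(1)[OF small]])
      show "0 \<le> 4 * (cube_constant + 8 / truncated_moment) * (r * b)"
        using cube_constant_pos truncated_moment_pos r b
            by (intro mult_nonneg_nonneg add_nonneg_nonneg) auto
      show "1 / 4 * r \<le> s ^ 3 * r" using s3 r by (intro mult_right_mono) auto
      show "0 < 1 / 4 * r" using r by simp
    qed
    also have "\<dots> = 16 * (cube_constant + 8 / truncated_moment) * b" using r by simp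
    finally have "berry_esseen_constant * ((\<integral>x. \<bar>w x - m\<bar> ^ 3 \<partial>\<nu>) / (s ^ 3 * r))
        \<le> berry_esseen_constant * (16 * (cube_constant + 8 / truncated_moment) * b)"
      using berry_esseen_constant_pos by (intro mult_left_mono) auto
    then show ?thesis by (simp add: mult.assoc)
  qed
  define d where "d = - (r * (m + t))"
  have "(0 - real n * m) / (s * r) = (r * t + d) / s"
    using r s by (simp add: d_def divide_simps) (simp add: algebra_simps)
  moreover have "\<bar>?\<Phi> ((r * t + d) / s) - ?\<Phi> (r * t)\<bar> \<le> 2 * (variance_constant A * b) + mean_constant A * b"
  proof -
    have "\<bar>?\<Phi> ((r * t + d) / s) - ?\<Phi> (r * t + d)\<bar> \<le> 2 * (variance_constant A * b)"
      by (rule order_trans[OF cdf_std_normal_divide[OF s s_half] mult_left_mono[OF var]]) simp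
    moreover have "\<bar>?\<Phi> (r * t + d) - ?\<Phi> (r * t)\<bar> \<le> mean_constant A * b"
      using cdf_std_normal_lipschitz[of "r * t + d" "r * t"] scaled_m_near_minus_t unfolding d_def by simp
    ultimately show ?thesis by linarith
  qed
  ultimately have center: "\<bar>?\<Phi> ((0 - real n * m) / (s * r)) - ?\<Phi> (r * t)\<bar>
      \<le> 2 * (variance_constant A * b) + mean_constant A * b" by simp
  have BE: "\<bar>measure M {\<omega> \<in> space M. (\<Sum>i=1..n. w (Y i \<omega>)) \<le> 0} - ?\<Phi> ((0 - real n * m) / (s * r))\<bar>
      \<le> berry_esseen_constant * (\<integral>x. \<bar>w x - m\<bar> ^ 3 \<partial>\<nu>) / (s ^ 3 * r)"
    "\<bar>measure M {\<omega> \<in> space M. (\<Sum>i=1..n. w (Y i \<omega>)) < 0} - ?\<Phi> ((0 - real n * m) / (s * r))\<bar>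
      \<le> berry_esseen_constant * (\<integral>x. \<bar>w x - m\<bar> ^ 3 \<partial>\<nu>) / (s ^ 3 * r)"
    unfolding third[symmetric]
    by (rule berry_esseen_iid[OF M indep' n law int mean variance s]; assumption)+
  have split_constant: "cdf_constant A * b
      = berry_esseen_constant * 16 * (cube_constant + 8 / truncated_moment) * b
          + (2 * (variance_constant A * b) + mean_constant A * b)"
    by (simp add: cdf_constant_def distrib_right)
  show "\<bar>measure M {\<omega> \<in> space M. (\<Sum>i=1..n. w (Y i \<omega>)) \<le> 0} - ?\<Phi> (r * t)\<bar> \<le> cdf_constant A * b"
    "\<bar>measure M {\<omega> \<in> space M. (\<Sum>i=1..n. w (Y i \<omega>)) < 0} - ?\<Phi> (r * t)\<bar> \<le> cdf_constant A * b"
    unfolding split_constant using BE rate center by linarith+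
qed

text \<open>
  Outside the event \<open>E\<close> that some observation exceeds \<open>r\<close> in absolute value, the sign of the
  truncated sum is that of \<open>\<Sum> \<phi>(a (Y\<^sub>i - t))\<close>. By monotonicity of \<open>\<phi>\<close> this sign tells on which
  side of \<open>t\<close> a root lies; only when the sum vanishes is the side undecided, hence the two
  versions, strict and weak, of the previous lemma.
\<close>

lemma cdf_estimator:
  fixes M :: "'a measure" and Y :: "nat \<Rightarrow> 'a \<Rightarrow> real" and \<theta> :: "'a \<Rightarrow> real"
  assumes M: "prob_space M" and indep: "prob_space.indep_vars M (\<lambda>_. borel) Y {1..n}"
    and Y: "\<And>i. i \<in> {1..n} \<Longrightarrow> distr M borel (Y i) = \<nu>"
    and small: "2 * variance_constant A * b \<le> 1"
    and \<theta>: "\<theta> \<in> borel_measurable M"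
    and zero: "\<And>\<omega>. \<omega> \<in> space M \<Longrightarrow> (\<Sum>i=1..n. \<phi> (a * (Y i \<omega> - \<theta> \<omega>))) = 0"
  shows "\<bar>measure M {\<omega> \<in> space M. \<theta> \<omega> \<le> t} - cdf std_normal_distribution (r * t)\<bar>
      \<le> (cdf_constant A + 1) * b"
proof -
  let ?\<Phi> = "cdf std_normal_distribution"
  interpret M: prob_space M by (rule M)
  have Ym [measurable]: "Y i \<in> borel_measurable M" if "i \<in> {1..n}" for i
    using indep that unfolding M.indep_vars_def2 by auto
  note \<theta> [measurable]
  let ?E = "\<Union>i\<in>{1..n}. {\<omega> \<in> space M. Y i \<omega> \<in> J}"
  let ?S = "\<lambda>\<omega>. \<Sum>i=1..n. w (Y i \<omega>)"
  have Ei: "measure M {\<omega> \<in> space M. Y i \<omega> \<in> J} = measure \<nu> J" if i: "i \<in> {1..n}" for i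
    using Ym[OF i] by (subst Y[OF i, symmetric], subst measure_distr)
      (auto intro!: arg_cong[where f = "measure M"])
  have sets_E: "{\<omega> \<in> space M. Y i \<omega> \<in> J} \<in> sets M" if i: "i \<in> {1..n}" for i
    using Ym[OF i] by measurable
  have [measurable]: "?E \<in> sets M" using sets_E by (intro sets.finite_UN) auto
  have "measure M ?E \<le> (\<Sum>i=1..n. measure M {\<omega> \<in> space M. Y i \<omega> \<in> J})"
    using sets_E by (intro M.finite_measure_subadditive_finite) auto
  also have "\<dots> = real n * measure \<nu> J" using Ei by simp
  also have "\<dots> \<le> b" by (rule tail_prob_le)
  finally have E: "measure M ?E \<le> b" .
  have S: "?S \<omega> = (\<Sum>i=1..n. \<phi> (a * (Y i \<omega> - t))) / a" if "\<omega> \<in> space M - ?E" for \<omega>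
  proof -
    have "w (Y i \<omega>) = \<phi> (a * (Y i \<omega> - t)) / a" if "i \<in> {1..n}" for i
      using \<open>\<omega> \<in> space M - ?E\<close> that by (auto simp: w_def W_def not_less)
    then show ?thesis by (simp add: sum_divide_distrib)
  qed
  have le: "?S \<omega> \<le> 0" if "\<omega> \<in> space M - ?E" "\<theta> \<omega> \<le> t" for \<omega>
  proof -
    have "(\<Sum>i=1..n. \<phi> (a * (Y i \<omega> - t))) \<le> (\<Sum>i=1..n. \<phi> (a * (Y i \<omega> - \<theta> \<omega>)))"
      using that a by (intro sum_mono catoni_influence_mono[OF \<phi>] mult_left_mono) auto
    also have "\<dots> = 0" using zero[of \<omega>] that by simp
    finally show ?thesis unfolding S[OF that(1)] using a by (simp add: divide_le_0_iff)
  qed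
  have ge: "0 \<le> ?S \<omega>" if "\<omega> \<in> space M - ?E" "t < \<theta> \<omega>" for \<omega>
  proof -
    have "0 = (\<Sum>i=1..n. \<phi> (a * (Y i \<omega> - \<theta> \<omega>)))" using zero[of \<omega>] that by simp
    also have "\<dots> \<le> (\<Sum>i=1..n. \<phi> (a * (Y i \<omega> - t)))"
      using that a by (intro sum_mono catoni_influence_mono[OF \<phi>] mult_left_mono) auto
    finally show ?thesis unfolding S[OF that(1)] using a by simp
  qed
  have Sm [measurable]: "?S \<in> borel_measurable M"
    using Ym by (intro borel_measurable_sum measurable_compose[OF _ measurable_w]) auto
  have "measure M {\<omega> \<in> space M. \<theta> \<omega> \<le> t} \<le> measure M ({\<omega> \<in> space M. ?S \<omega> \<le> 0} \<union> ?E)"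
    using le by (intro M.finite_measure_mono) auto
  also have "\<dots> \<le> measure M {\<omega> \<in> space M. ?S \<omega> \<le> 0} + measure M ?E"
    by (intro measure_Un_le) auto
  finally have upper: "measure M {\<omega> \<in> space M. \<theta> \<omega> \<le> t} \<le> measure M {\<omega> \<in> space M. ?S \<omega> \<le> 0} + b"
    using E by linarith
  have "{\<omega> \<in> space M. ?S \<omega> < 0} \<subseteq> {\<omega> \<in> space M. \<theta> \<omega> \<le> t} \<union> ?E"
  proof
    fix \<omega> assume "\<omega> \<in> {\<omega> \<in> space M. ?S \<omega> < 0}"
    then show "\<omega> \<in> {\<omega> \<in> space M. \<theta> \<omega> \<le> t} \<union> ?E"
      using ge[of \<omega>] by (cases "\<theta> \<omega> \<le> t"; cases "\<omega> \<in> ?E") auto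
  qed
  then have "measure M {\<omega> \<in> space M. ?S \<omega> < 0} \<le> measure M ({\<omega> \<in> space M. \<theta> \<omega> \<le> t} \<union> ?E)"
    by (intro M.finite_measure_mono) auto
  also have "\<dots> \<le> measure M {\<omega> \<in> space M. \<theta> \<omega> \<le> t} + measure M ?E"
    by (intro measure_Un_le) auto
  finally have lower: "measure M {\<omega> \<in> space M. ?S \<omega> < 0} \<le> measure M {\<omega> \<in> space M. \<theta> \<omega> \<le> t} + b"
    using E by linarith
  have "(cdf_constant A + 1) * b = cdf_constant A * b + b" by (simp add: distrib_right)
  moreover have "\<bar>measure M {\<omega> \<in> space M. ?S \<omega> \<le> 0} - ?\<Phi> (r * t)\<bar> \<le> cdf_constant A * b"
    "\<bar>measure M {\<omega> \<in> space M. ?S \<omega> < 0} - ?\<Phi> (r * t)\<bar> \<le> cdf_constant A * b"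
    by (rule cdf_truncated_sum[OF M indep Y small]; assumption)+
  ultimately show ?thesis using upper lower by linarith
qed

end

context standardized_law
begin

definition center_constant :: "real \<Rightarrow> real" where
  "center_constant A = A\<^sup>2 * (cube_constant) + 4 * A + 1"

definition rate_constant :: "real \<Rightarrow> real" where
  "rate_constant A = cdf_constant A + 1 + 1 / truncated_moment + 2 * variance_constant A
      + center_constant A"

lemma constants_pos:
  assumes "0 \<le> A"
  shows "0 < cdf_constant A" "0 < variance_constant A" "0 < center_constant A"
    "0 < mean_constant A"
proof -
  have L: "0 < cube_constant" "0 < cube_constant + 8 / truncated_moment"
    using truncated_moment_pos cube_constant_pos
        by (auto intro!: add_pos_pos simp del: distrib_left_numeral)
  show m: "0 < mean_constant A" unfolding mean_constant_def
    using L assms truncated_moment_pos by (intro add_nonneg_pos mult_nonneg_nonneg) auto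
  show v: "0 < variance_constant A" unfolding variance_constant_def
    using L assms m truncated_moment_pos by (intro add_nonneg_pos add_nonneg_nonneg mult_nonneg_nonneg) auto
  show "0 < center_constant A" unfolding center_constant_def
    using L assms truncated_moment_pos by (intro add_nonneg_pos add_nonneg_nonneg mult_nonneg_nonneg) auto
  show "0 < cdf_constant A" unfolding cdf_constant_def
    using L m v berry_esseen_constant_pos truncated_moment_pos by (intro add_pos_pos mult_pos_pos) auto
qed

text \<open>
  At \<open>t = 1\<close> and \<open>t = - 1\<close> both functions are within \<open>O(b) + 1 / n\<close> of 1 and 0 respectively, and
  \<open>1 / n\<close> is itself \<open>O(b)\<close>. By monotonicity they stay there beyond these points.
\<close>

lemma cdf_estimator_everywhere:
  fixes M :: "'a measure" and Y :: "nat \<Rightarrow> 'a \<Rightarrow> real" and \<theta> :: "'a \<Rightarrow> real"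
  assumes \<phi>: "catoni_influence \<phi>" and n: "1 \<le> n" and a: "0 < a" and aA: "sqrt (real n) * a \<le> A"
    and M: "prob_space M" and indep: "prob_space.indep_vars M (\<lambda>_. borel) Y {1..n}"
    and Y: "\<And>i. i \<in> {1..n} \<Longrightarrow> distr M borel (Y i) = \<nu>"
    and small: "2 * variance_constant A * beta n \<le> 1"
    and \<theta>: "\<theta> \<in> borel_measurable M"
    and zero: "\<And>\<omega>. \<omega> \<in> space M \<Longrightarrow> (\<Sum>i=1..n. \<phi> (a * (Y i \<omega> - \<theta> \<omega>))) = 0"
  shows "\<bar>measure M {\<omega> \<in> space M. \<theta> \<omega> \<le> t} - cdf std_normal_distribution (sqrt (real n) * t)\<bar>
    \<le> (cdf_constant A + 1 + 1 / truncated_moment) * beta n"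
proof -
  let ?\<Phi> = "cdf std_normal_distribution" and ?r = "sqrt (real n)" and ?b = "beta n"
  let ?F = "\<lambda>t. measure M {\<omega> \<in> space M. \<theta> \<omega> \<le> t}"
  interpret M: prob_space M by (rule M)
  interpret N: real_distribution std_normal_distribution by (rule real_dist_normal_dist)
  note \<theta> [measurable]
  have r: "1 \<le> ?r" using n by simp
  have bulk: "\<bar>?F t - ?\<Phi> (?r * t)\<bar> \<le> (cdf_constant A + 1) * ?b" if "\<bar>t\<bar> \<le> 1" for t
  proof -
    interpret catoni_step \<nu> \<phi> a A t n
      by unfold_locales (use \<phi> n a aA that in auto)
    show ?thesis by (rule cdf_estimator[OF M indep Y small \<theta> zero])
  qed
  have r2: "1 / ?r\<^sup>2 \<le> 1 / truncated_moment * ?b"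
  proof -
    have "1 / ?r\<^sup>2 \<le> 1 / ?r"
      using mult_left_mono[OF r, of ?r] r by (intro divide_left_mono) (auto simp: power2_eq_square)
    also have "\<dots> \<le> 1 / truncated_moment * ?b"
      using truncated_moment_le[OF n] truncated_moment_pos r by (simp add: field_simps)
    finally show ?thesis .
  qed
  have tails: "?\<Phi> (- ?r) \<le> 1 / ?r\<^sup>2" "1 - ?\<Phi> ?r \<le> 1 / ?r\<^sup>2"
    using r by (intro std_normal_tails; simp)+
  have F_mono: "?F s \<le> ?F t" if "s \<le> t" for s t
    using that by (intro M.finite_measure_mono) auto
  have sum: "(cdf_constant A + 1 + 1 / truncated_moment) * ?b
      = (cdf_constant A + 1) * ?b + 1 / truncated_moment * ?b"
    by (simp only: distrib_right)
  consider "\<bar>t\<bar> \<le> 1" | "1 < t" | "t < - 1" by linarith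
  then have "\<bar>?F t - ?\<Phi> (?r * t)\<bar> \<le> (cdf_constant A + 1) * ?b + 1 / ?r\<^sup>2"
  proof cases
    case 1
    then show ?thesis using bulk[of t] by (simp add: add_increasing2)
  next
    case 2
    have "?r * 1 \<le> ?r * t" using 2 r by (intro mult_left_mono) auto
    then have "?\<Phi> ?r \<le> ?\<Phi> (?r * t)" by (intro N.cdf_nondecreasing) simp
    moreover have "?F 1 \<le> ?F t" using 2 by (intro F_mono) simp
    moreover have "?F t \<le> 1" "?\<Phi> (?r * t) \<le> 1" by (auto simp: N.cdf_bounded_prob)
    moreover have "\<bar>?F 1 - ?\<Phi> ?r\<bar> \<le> (cdf_constant A + 1) * ?b" using bulk[of 1] by simp
    ultimately show ?thesis using tails(2) unfolding abs_le_iff by linarith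
  next
    case 3
    have "?r * t \<le> ?r * (- 1)" using 3 r by (intro mult_left_mono) auto
    then have "?\<Phi> (?r * t) \<le> ?\<Phi> (- ?r)" by (intro N.cdf_nondecreasing) simp
    moreover have "?F t \<le> ?F (- 1)" using 3 by (intro F_mono) simp
    moreover have "0 \<le> ?F t" "0 \<le> ?\<Phi> (?r * t)" by (auto simp: N.cdf_nonneg)
    moreover have "\<bar>?F (- 1) - ?\<Phi> (- ?r)\<bar> \<le> (cdf_constant A + 1) * ?b" using bulk[of "- 1"] by simp
    ultimately show ?thesis using tails(1) unfolding abs_le_iff by linarith
  qed
  with r2 show ?thesis unfolding sum by linarith
qed

text \<open>
  The map \<open>t \<mapsto> E \<phi>(a (x - t)) / a\<close> is non-increasing and equals \<open>- t\<close> up to an error less than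
  \<open>T\<close>, so it is negative at \<open>T\<close> and positive at \<open>- T\<close>. Every zero lies in between.
\<close>

lemma scaled_center_le:
  assumes \<phi>: "catoni_influence \<phi>" and n: "1 \<le> n" and a: "0 < a" and aA: "sqrt (real n) * a \<le> A"
    and v: "catoni_center \<nu> \<phi> a v" and small: "center_constant A * beta n \<le> 1"
  shows "\<bar>sqrt (real n) * v\<bar> \<le> center_constant A * beta n"
proof -
  let ?r = "sqrt (real n)" and ?b = "beta n"
  have r: "1 \<le> ?r" using n by simp
  have b: "0 < ?b" using n by (rule beta_pos)
  have "0 \<le> A" using aA a r by (meson less_imp_le mult_nonneg_nonneg order_trans zero_le_one)
  note pos = constants_pos(3)[OF this]
  (* The summand 1 in center_constant makes T exceed the error of mean_W by b / r > 0. *)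
  define T where "T = center_constant A * (?b / ?r)"
  have T: "0 \<le> T" "T \<le> 1"
  proof -
    show "0 \<le> T" using pos b r by (simp add: T_def)
    have "T = center_constant A * ?b / ?r" by (simp add: T_def)
    also have "\<dots> \<le> 1 / 1" using small r by (intro frac_le) auto
    finally show "T \<le> 1" by simp
  qed
  have mean: "\<bar>(\<integral>x. \<phi> (a * (x - t)) / a \<partial>\<nu>) + t\<bar> \<le> T - ?b / ?r"
    and int: "integrable \<nu> (\<lambda>x. \<phi> (a * (x - t)) / a)" if "\<bar>t\<bar> \<le> 1" for t
  proof -
    interpret catoni_step \<nu> \<phi> a A t n
      by unfold_locales (use \<phi> n a aA that in auto)
    show "integrable \<nu> (\<lambda>x. \<phi> (a * (x - t)) / a)" using integrable_W unfolding W_def .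
    have "T - ?b / ?r = (A\<^sup>2 * (cube_constant) + 4 * A) * (?b / ?r)"
      by (simp add: T_def center_constant_def algebra_simps)
    then show "\<bar>(\<integral>x. \<phi> (a * (x - t)) / a \<partial>\<nu>) + t\<bar> \<le> T - ?b / ?r"
      using mean_W unfolding W_def by simp
  qed
  have int_all: "integrable \<nu> (\<lambda>x. \<phi> (a * (x - t)) / a)" for t
  proof (rule Bochner_Integration.integrable_bound)
    show "integrable \<nu> (\<lambda>x. x - t)" using integrable_id by simp
    show "(\<lambda>x. \<phi> (a * (x - t)) / a) \<in> borel_measurable \<nu>"
      using measurable_catoni_influence[OF \<phi>] by measurable
    have "\<bar>\<phi> (a * (x - t)) / a\<bar> \<le> \<bar>x - t\<bar>" for x
      using catoni_influence_bounds(1)[OF \<phi>, of "a * (x - t)"] a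
      by (simp add: abs_mult divide_le_eq mult.commute)
    then show "AE x in \<nu>. norm (\<phi> (a * (x - t)) / a) \<le> norm (x - t)" by simp
  qed
  have anti: "(\<integral>x. \<phi> (a * (x - t)) / a \<partial>\<nu>) \<le> (\<integral>x. \<phi> (a * (x - s)) / a \<partial>\<nu>)" if "s \<le> t" for s t
    using that a by (intro integral_mono int_all divide_right_mono catoni_influence_mono[OF \<phi>] mult_left_mono) auto
  have zero: "(\<integral>x. \<phi> (a * (x - v)) / a \<partial>\<nu>) = 0" using v by (simp add: catoni_center_def)
  have br: "0 < ?b / ?r" using b r by simp
  have "v < T"
  proof (rule ccontr)
    assume "\<not> v < T"
    then have "(\<integral>x. \<phi> (a * (x - v)) / a \<partial>\<nu>) \<le> (\<integral>x. \<phi> (a * (x - T)) / a \<partial>\<nu>)" by (intro anti) simp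
    moreover have "\<bar>(\<integral>x. \<phi> (a * (x - T)) / a \<partial>\<nu>) + T\<bar> \<le> T - ?b / ?r" using T by (intro mean) simp
    ultimately show False using zero br by linarith
  qed
  moreover have "- T < v"
  proof (rule ccontr)
    assume "\<not> - T < v"
    then have "(\<integral>x. \<phi> (a * (x - (- T))) / a \<partial>\<nu>) \<le> (\<integral>x. \<phi> (a * (x - v)) / a \<partial>\<nu>)" by (intro anti) simp
    moreover have "\<bar>(\<integral>x. \<phi> (a * (x - (- T))) / a \<partial>\<nu>) + (- T)\<bar> \<le> T - ?b / ?r" using T by (intro mean) simp
    ultimately show False using zero br by linarith
  qed
  ultimately have "\<bar>v\<bar> \<le> T" by simp
  then have "?r * \<bar>v\<bar> \<le> ?r * T" using r by (intro mult_left_mono) auto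
  also have "\<dots> = center_constant A * ?b" using r by (simp add: T_def)
  finally show ?thesis using r by (simp add: abs_mult)
qed

text \<open>
  If \<open>b\<close> is not small, the right-hand side is at least 1. Otherwise the law of the estimator is
  known at \<open>v + z / r\<close>, and \<open>r * v = O(b)\<close> is a negligible shift of \<open>z\<close>.
\<close>

theorem catoni_berry_esseen_standardized:
  fixes M :: "'a measure" and Y :: "nat \<Rightarrow> 'a \<Rightarrow> real" and \<theta> :: "'a \<Rightarrow> real"
  assumes \<phi>: "catoni_influence \<phi>" and n: "1 \<le> n" and a: "0 < a" and aA: "sqrt (real n) * a \<le> A"
    and M: "prob_space M" and indep: "prob_space.indep_vars M (\<lambda>_. borel) Y {1..n}"
    and Y: "\<And>i. i \<in> {1..n} \<Longrightarrow> distr M borel (Y i) = \<nu>"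
    and \<theta>: "\<theta> \<in> borel_measurable M"
    and zero: "\<And>\<omega>. \<omega> \<in> space M \<Longrightarrow> (\<Sum>i=1..n. \<phi> (a * (Y i \<omega> - \<theta> \<omega>))) = 0"
    and v: "catoni_center \<nu> \<phi> a v"
  shows "\<bar>measure M {\<omega> \<in> space M. sqrt (real n) * (\<theta> \<omega> - v) \<le> z} - cdf std_normal_distribution z\<bar>
    \<le> rate_constant A * beta n"
proof -
  let ?\<Phi> = "cdf std_normal_distribution" and ?r = "sqrt (real n)" and ?b = "beta n"
  let ?P = "measure M {\<omega> \<in> space M. ?r * (\<theta> \<omega> - v) \<le> z}"
  interpret M: prob_space M by (rule M)
  interpret N: real_distribution std_normal_distribution by (rule real_dist_normal_dist)
  have r: "1 \<le> ?r" using n by simp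
  have b: "0 < ?b" using n by (rule beta_pos)
  have "0 \<le> A" using aA a r by (meson less_imp_le mult_nonneg_nonneg order_trans zero_le_one)
  note pos = constants_pos[OF this]
  have nonneg: "0 \<le> cdf_constant A * ?b" "0 \<le> variance_constant A * ?b" "0 \<le> center_constant A * ?b"
    "0 \<le> 1 / truncated_moment * ?b"
    using pos b truncated_moment_pos by simp_all
  have sum: "rate_constant A * ?b = (cdf_constant A + 1 + 1 / truncated_moment) * ?b
      + 2 * variance_constant A * ?b + center_constant A * ?b"
    by (simp only: rate_constant_def distrib_right)
  have sum1: "(cdf_constant A + 1 + 1 / truncated_moment) * ?b
      = cdf_constant A * ?b + ?b + 1 / truncated_moment * ?b"
    by (simp only: distrib_right mult_1)
  show ?thesis
  proof (cases "2 * variance_constant A * ?b \<le> 1 \<and> center_constant A * ?b \<le> 1")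
    case True
    then have small: "2 * variance_constant A * ?b \<le> 1" "center_constant A * ?b \<le> 1" by auto
    have eq: "{\<omega> \<in> space M. ?r * (\<theta> \<omega> - v) \<le> z} = {\<omega> \<in> space M. \<theta> \<omega> \<le> v + z / ?r}"
      using r by (auto simp: field_simps)
    have "\<bar>?P - ?\<Phi> (?r * (v + z / ?r))\<bar> \<le> (cdf_constant A + 1 + 1 / truncated_moment) * ?b"
      unfolding eq by (rule cdf_estimator_everywhere[OF \<phi> n a aA M indep Y small(1) \<theta> zero])
    moreover have "?r * (v + z / ?r) = ?r * v + z" using r by (simp add: distrib_left)
    moreover have "\<bar>?\<Phi> (?r * v + z) - ?\<Phi> z\<bar> \<le> \<bar>?r * v\<bar>"
      using cdf_std_normal_lipschitz[of "?r * v + z" z] by simp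
    moreover have "\<bar>?r * v\<bar> \<le> center_constant A * ?b"
      by (rule scaled_center_le[OF \<phi> n a aA v small(2)])
    ultimately show ?thesis using nonneg unfolding sum by simp
  next
    case False
    then have "1 \<le> rate_constant A * ?b" using nonneg b unfolding sum sum1 by auto
    moreover have "0 \<le> ?P" "?P \<le> 1" by auto
    ultimately show ?thesis
      using N.cdf_nonneg[of z] N.cdf_bounded_prob[of z] by linarith
  qed
qed

lemma rate_constant_pos: "0 \<le> A \<Longrightarrow> 0 < rate_constant A"
  using constants_pos[of A] truncated_moment_pos by (simp add: rate_constant_def add_pos_pos)

end

section \<open>Reduction to a standardised law\<close>

text \<open>
  The bound must hold for every \<open>n\<close>; finitely many early terms are absorbed into the sum.
\<close>

lemma bounded_of_limsup_le:
  fixes f :: "nat \<Rightarrow> real"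
  assumes "limsup (\<lambda>n. ereal (f n)) \<le> ereal c"
  obtains A where "0 \<le> A" "\<And>n. f n \<le> A"
proof -
  have "limsup (\<lambda>n. ereal (f n)) < ereal (c + 1)"
    using assms by (rule order_le_less_trans) simp
  then have "\<forall>\<^sub>F n in sequentially. ereal (f n) < ereal (c + 1)"
    by (rule Limsup_lessD)
  then obtain N where N: "\<And>n. N \<le> n \<Longrightarrow> f n < c + 1" by (auto simp: eventually_sequentially)
  define A where "A = (\<Sum>n<N. \<bar>f n\<bar>) + \<bar>c + 1\<bar>"
  have "f n \<le> A" for n
  proof (cases "n < N")
    case True
    then have "\<bar>f n\<bar> \<le> (\<Sum>n<N. \<bar>f n\<bar>)" by (intro member_le_sum) auto
    then show ?thesis unfolding A_def by linarith
  next
    case False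
    then have "f n < c + 1" by (intro N) simp
    moreover have "0 \<le> (\<Sum>n<N. \<bar>f n\<bar>)" by (intro sum_nonneg) simp
    ultimately show ?thesis unfolding A_def by linarith
  qed
  moreover have "0 \<le> A" by (simp add: A_def sum_nonneg)
  ultimately show ?thesis using that by blast
qed

lemma standardized_law_distr:
  assumes law: "real_distribution D" and sq: "integrable D (\<lambda>x. x\<^sup>2)"
    and u: "u = (\<integral>x. x \<partial>D)" and var: "\<sigma>\<^sup>2 = (\<integral>x. (x - u)\<^sup>2 \<partial>D)" and \<sigma>: "\<sigma> > 0"
  shows "standardized_law (distr D borel (\<lambda>x. (x - u) / \<sigma>))"
proof -
  interpret D: real_distribution D by (rule law)
  have int: "integrable D (\<lambda>x. x)" by (rule D.square_integrable_imp_integrable[OF _ sq]) simp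
  have int2: "integrable D (\<lambda>x. (x - u)\<^sup>2)" using int sq by (simp add: power2_diff)
  show ?thesis
  proof (intro standardized_law.intro standardized_law_axioms.intro)
    show "real_distribution (distr D borel (\<lambda>x. (x - u) / \<sigma>))" by simp
    show "integrable (distr D borel (\<lambda>x. (x - u) / \<sigma>)) (\<lambda>x. x\<^sup>2)"
      using int2 by (subst integrable_distr_eq) (auto simp: power_divide)
    show "(\<integral>x. x \<partial>distr D borel (\<lambda>x. (x - u) / \<sigma>)) = 0"
    proof (subst integral_distr)
      have "(\<integral>x. x - u \<partial>D) = 0"
        using int D.prob_space u by (simp add: Bochner_Integration.integral_diff)
      then show "(\<integral>x. (x - u) / \<sigma> \<partial>D) = 0" by simp
    qed auto
    show "(\<integral>x. x\<^sup>2 \<partial>distr D borel (\<lambda>x. (x - u) / \<sigma>)) = 1"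
    proof (subst integral_distr)
      have "(\<integral>x. ((x - u) / \<sigma>)\<^sup>2 \<partial>D) = (\<integral>x. (x - u)\<^sup>2 \<partial>D) / \<sigma>\<^sup>2" by (simp add: power_divide)
      then show "(\<integral>x. ((x - u) / \<sigma>)\<^sup>2 \<partial>D) = 1" using \<sigma> by (simp flip: var)
    qed auto
  qed
qed

lemma beta_standardize:
  assumes law: "real_distribution D" and \<sigma>: "\<sigma> > 0"
  shows "beta2 (distr D borel (\<lambda>x. (x - u) / \<sigma>)) 0 1 n = beta2 D u \<sigma> n"
    and "beta3 (distr D borel (\<lambda>x. (x - u) / \<sigma>)) 0 1 n = beta3 D u \<sigma> n"
proof -
  interpret D: real_distribution D by (rule law)
  let ?r = "sqrt (real n)"
  have "beta2 (distr D borel (\<lambda>x. (x - u) / \<sigma>)) 0 1 n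
      = (\<integral>x. \<bar>(x - u) / \<sigma>\<bar> ^ 2 * indicator {y. ?r \<le> \<bar>y\<bar>} ((x - u) / \<sigma>) \<partial>D)"
    unfolding beta2_def by (subst integral_distr) auto
  also have "\<dots> = (\<integral>x. 1 / \<sigma>\<^sup>2 * (\<bar>x - u\<bar> ^ 2 * indicator {x. ?r * \<sigma> \<le> \<bar>x - u\<bar>} x) \<partial>D)"
    using \<sigma> by (intro Bochner_Integration.integral_cong)
      (auto simp: power_divide le_divide_eq split: split_indicator)
  finally show "beta2 (distr D borel (\<lambda>x. (x - u) / \<sigma>)) 0 1 n = beta2 D u \<sigma> n"
    by (simp add: beta2_def)
  have "beta3 (distr D borel (\<lambda>x. (x - u) / \<sigma>)) 0 1 n
      = 1 / ?r * (\<integral>x. \<bar>(x - u) / \<sigma>\<bar> ^ 3 * indicator {y. \<bar>y\<bar> \<le> ?r} ((x - u) / \<sigma>) \<partial>D)"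
    unfolding beta3_def by (subst integral_distr) auto
  also have "(\<integral>x. \<bar>(x - u) / \<sigma>\<bar> ^ 3 * indicator {y. \<bar>y\<bar> \<le> ?r} ((x - u) / \<sigma>) \<partial>D)
      = (\<integral>x. 1 / \<sigma> ^ 3 * (\<bar>x - u\<bar> ^ 3 * indicator {x. \<bar>x - u\<bar> \<le> ?r * \<sigma>} x) \<partial>D)"
    using \<sigma> by (intro Bochner_Integration.integral_cong)
      (auto simp: power_divide divide_le_eq split: split_indicator)
  finally show "beta3 (distr D borel (\<lambda>x. (x - u) / \<sigma>)) 0 1 n = beta3 D u \<sigma> n"
    by (simp add: beta3_def)
qed

lemma measurable_sample_algebra:
  assumes X: "\<And>i. i \<in> {1..n} \<Longrightarrow> X i \<in> borel_measurable M"
    and \<theta>: "\<theta> \<in> borel_measurable (sample_algebra M X n)"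
  shows "\<theta> \<in> borel_measurable M"
proof (rule measurable_from_subalg[OF _ \<theta>])
  have "(\<lambda>\<omega>. \<lambda>i\<in>{1..n}. X i \<omega>) \<in> measurable M (PiM {1..n} (\<lambda>_. borel))"
    using X by (intro measurable_restrict) auto
  then show "subalgebra M (sample_algebra M X n)"
    unfolding subalgebra_def sample_algebra_def by (simp add: sets_image_in_sets)
qed

text \<open>
  Everything is invariant under the affine change \<open>x \<mapsto> (x - u) / \<sigma>\<close>, under which \<open>\<alpha>\<^sub>n = a n / \<sigma>\<close>
  becomes \<open>a n\<close>. The constant depends on the law and on the bound \<open>A\<close> of the sequence
  \<open>sqrt n * a n\<close> only.
\<close>

theorem theorem2p1:
  fixes D :: "real measure" and u \<sigma> C\<^sub>0 :: real and a :: "nat \<Rightarrow> real"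
  assumes law: "real_distribution D"
    and square_integrable: "integrable D (\<lambda>x. x\<^sup>2)"
    and mean: "u = (\<integral>x. x \<partial>D)"
    and variance: "\<sigma>\<^sup>2 = (\<integral>x. (x - u)\<^sup>2 \<partial>D)"
    and sigma_pos: "\<sigma> > 0"
    and a_pos: "\<And>n. n \<ge> 1 \<Longrightarrow> a n > 0"
    and C0_nonneg: "C\<^sub>0 \<ge> 0"
    and limsup_a: "limsup (\<lambda>n. ereal (sqrt (real n) * a n)) \<le> ereal C\<^sub>0"
  shows "\<exists>C>0. \<forall>(M :: 'a measure) X \<phi> \<theta> v.
           iid_sequence M X D \<longrightarrow>
           catoni_influence \<phi> \<longrightarrow>
           (\<forall>n\<ge>1. catoni_estimator M X \<phi> (a n / \<sigma>) n (\<theta> n)) \<longrightarrow>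
           (\<forall>n\<ge>1. catoni_center D \<phi> (a n / \<sigma>) (v n)) \<longrightarrow>
           (\<forall>n\<ge>1. (SUP z. \<bar>measure M {\<omega> \<in> space M. sqrt (real n) * (\<theta> n \<omega> - v n) / \<sigma> \<le> z}
                            - cdf std_normal_distribution z\<bar>)
                   \<le> C * beta2 D u \<sigma> n + C * beta3 D u \<sigma> n)"
proof -
  let ?std = "\<lambda>x. (x - u) / \<sigma>"
  let ?\<nu> = "distr D borel ?std"
  interpret D: real_distribution D by (rule law)
  interpret standardized_law ?\<nu>
    by (rule standardized_law_distr[OF law square_integrable mean variance sigma_pos])
  obtain A where A: "0 \<le> A" "\<And>n. sqrt (real n) * a n \<le> A"
    using bounded_of_limsup_le[OF limsup_a] by blast
  show ?thesis
  proof (intro exI[of _ "rate_constant A"] conjI allI impI)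
    show "0 < rate_constant A" by (rule rate_constant_pos[OF A(1)])
    fix M :: "'a measure" and X \<phi> \<theta> v and n :: nat
    assume iid: "iid_sequence M X D" and \<phi>: "catoni_influence \<phi>"
      and est: "\<forall>n\<ge>1. catoni_estimator M X \<phi> (a n / \<sigma>) n (\<theta> n)"
      and cen: "\<forall>n\<ge>1. catoni_center D \<phi> (a n / \<sigma>) (v n)" and n: "1 \<le> n"
    interpret M: prob_space M using iid by (simp add: iid_sequence_def)
    have indep: "M.indep_vars (\<lambda>_. borel) X {1..}"
      and law_X: "\<And>i. 1 \<le> i \<Longrightarrow> distr M borel (X i) = D"
      using iid by (auto simp: iid_sequence_def)
    have X [measurable]: "X i \<in> borel_measurable M" if "1 \<le> i" for i
      using indep that unfolding M.indep_vars_def2 by auto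
    let ?Y = "\<lambda>i \<omega>. ?std (X i \<omega>)" and ?\<theta> = "\<lambda>\<omega>. ?std (\<theta> n \<omega>)"
    have indep_Y: "M.indep_vars (\<lambda>_. borel) ?Y {1..n}"
      by (rule M.indep_vars_compose2[OF M.indep_vars_subset[OF indep]]) auto
    have law_Y: "distr M borel (?Y i) = ?\<nu>" if "i \<in> {1..n}" for i
      using that X[of i] by (simp add: distr_distr comp_def flip: law_X[of i])
    have \<theta>: "\<theta> n \<in> borel_measurable M"
    proof (rule measurable_sample_algebra)
      show "X i \<in> borel_measurable M" if "i \<in> {1..n}" for i using that by (intro X) simp
      show "\<theta> n \<in> borel_measurable (sample_algebra M X n)"
        using est n unfolding catoni_estimator_def by blast
    qed
    have scale: "a n / \<sigma> * (x - y) = a n * (?std x - ?std y)" for x y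
      by (simp add: diff_divide_distrib[symmetric])
    have zero: "(\<Sum>i=1..n. \<phi> (a n * (?Y i \<omega> - ?\<theta> \<omega>))) = 0" if "\<omega> \<in> space M" for \<omega>
    proof -
      have "catoni_estimator M X \<phi> (a n / \<sigma>) n (\<theta> n)" using est n by blast
      then have "(\<Sum>i=1..n. \<phi> (a n / \<sigma> * (X i \<omega> - \<theta> n \<omega>))) = 0"
        using that unfolding catoni_estimator_def by blast
      then show ?thesis by (simp only: scale)
    qed
    have center: "catoni_center ?\<nu> \<phi> (a n) (?std (v n))"
    proof -
      note measurable_catoni_influence[OF \<phi>, measurable]
      have "(\<integral>x. \<phi> (a n * (x - ?std (v n))) \<partial>?\<nu>) = (\<integral>x. \<phi> (a n * (?std x - ?std (v n))) \<partial>D)"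
        by (subst integral_distr) auto
      also have "\<dots> = (\<integral>x. \<phi> (a n / \<sigma> * (x - v n)) \<partial>D)" by (simp only: scale)
      also have "\<dots> = 0" using cen n unfolding catoni_center_def by blast
      finally show ?thesis by (simp add: catoni_center_def)
    qed
    have "\<bar>measure M {\<omega> \<in> space M. sqrt (real n) * (?\<theta> \<omega> - ?std (v n)) \<le> z} - cdf std_normal_distribution z\<bar>
        \<le> rate_constant A * beta n" for z
      using \<theta> by (intro catoni_berry_esseen_standardized[OF \<phi> n a_pos[OF n] A(2) M.prob_space_axioms
          indep_Y law_Y _ zero center]) auto
    moreover have "sqrt (real n) * (?\<theta> \<omega> - ?std (v n)) = sqrt (real n) * (\<theta> n \<omega> - v n) / \<sigma>" for \<omega>
      by (simp add: diff_divide_distrib[symmetric])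
    moreover have "rate_constant A * beta n
        = rate_constant A * beta2 D u \<sigma> n + rate_constant A * beta3 D u \<sigma> n"
      by (simp add: beta_def beta_standardize[OF law sigma_pos] distrib_left)
    ultimately show "(SUP z. \<bar>measure M {\<omega> \<in> space M. sqrt (real n) * (\<theta> n \<omega> - v n) / \<sigma> \<le> z}
                            - cdf std_normal_distribution z\<bar>)
        \<le> rate_constant A * beta2 D u \<sigma> n + rate_constant A * beta3 D u \<sigma> n"
      by (intro cSUP_least) auto
  qed
qed

end
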